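(* Let $\mathcal S=(+,+,+,\dots)$ be the sequence of all elementary foldings up. Let $\sigma$ denote the positive unit triangle $T_0$ centered at $O$ with all three sides red. Then for every $n\ge0$, the edge-colored triangle $F_P^n(\sigma)$ (which is the positive triangle $4^nT_0$ of side $4^n$ centered at $O$) coincides with $P_{\mathcal S}$ on all unit edges contained in $4^nT_0$; thus the substitution rule $F_P$ with seed $\sigma$ centered at the origin generates the pattern $P_{\mathcal S}$. Correspondingly, the tile substitution $F_T$ with the seed consisting of the positive tile with three red sides centered at the origin generates the decorated folding tiling $T_{\mathcal S}$.
   Context: Grid: let $\xi_1=(0,-2\sqrt3)$ and let $\xi_2,\xi_3$ be its counterclockwise rotations by $2\pi/3$ and $4\pi/3$. For $i\in\{1,2,3\}$, $n\in\mathbb Z$ put $\ell_{i,n}=\{x\in\mathbb R^2:(x,\xi_i)=3n+1\}$. The union $\mathcal L$ of all $\ell_{i,n}$ is a triangular grid whose smallest triangles (unit triangles) are regular of side $1$; unit edges are the sides of unit triangles. A regular triangle is positive if its vertex opposite its horizontal side lies above that side, negative otherwise. $O$ is the origin and $T_0$ is the positive unit triangle centered at $O$; $\lambda T_0$ denotes the image of $T_0$ under the homothety with center $O$ and ratio $\lambda$. Folding patterns: an elementary folding folds a paper regular triangle of side $2a$ along its three midsegments onto its central triangle of side $a$; it is a folding up ($+$) if all three folds go through the upper half-space of $\mathbb R^3$ and a folding down ($-$) if all go through the lower half-space. When unfolded, fold lines of a folding up become valleys and those of a folding down become peaks. For a finite sequence $(a_1,\dots,a_k)$ take the paper triangle $(-2)^kT_0$,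 perform $a_k$ first (onto $(-2)^{k-1}T_0$), then $a_{k-1}$, …, finally $a_1$ (onto $T_0$), then unfold; valleys are colored red and peaks blue. For an infinite sequence $\mathcal S=(a_i)_{i\ge1}$, $P_{\mathcal S}$ is the red/blue coloring of all unit edges of $\mathcal L$ in which each edge gets its color from the pattern of $(a_1,\dots,a_k)$ for any $k$ with the edge interior to $(-2)^kT_0$. The decorated folding tiling $T_{\mathcal S}$ is the tiling by the unit triangles of $\mathcal L$, each tile labeled by its orientation and its edge coloring in $P_{\mathcal S}$ (number of red sides plus, when this is $1$ or $2$, a mark on the side whose color differs from the other two). Substitutions: an edge-colored triangle is a regular triangle $\Delta$ of integer side $m$, subdivided into $m^2$ unit triangles by lines parallel to its sides, with each unit edge colored red or blue. The substitution $F_+$ maps it to the edge-colored triangle $2\Delta$ (homothety of ratio $2$ centered at the center of $\Delta$; same orientation, side $2m$), where each unit triangle $\tau$ of $\Delta$ becomes the triangle $2\tau$ of side $2$, subdivided into four unit triangles (three corner ones of the orientation of $\tau$ and a central one of the opposite orientation), colored as follows: each unit edge $e$ of $\Delta$ becomes a segment of length $2$ whose two unit edges both receive the color opposite to that of $e$; the three interior unit edges of $2\tau$ (its midsegments) are colored blue if $\tau$ is positive and red if $\tau$ is negative. The substitution $F_P$ is $F_+\circ F_+$ (inflation factor $4$). The tile substitution $F_T$ is the same rule expressed on decorated tiles: a tile is replaced by the $16$ decorated tiles read off from the $F_P$-image of the corresponding edge-colored unit triangle. *)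

theory Defs
  imports "HOL-Analysis.Analysis"
begin

text \<open>The plane is \<^typ>\<open>complex\<close> with its real inner product. Indices \<open>i\<close> of normals, vertices and
  sides are meant in \<open>{1,2,3}\<close>; \<open>xi\<close> is 3-periodic, so \<open>i + 1\<close> and \<open>i + 2\<close> denote the
  two other indices.\<close>

definition xi :: "nat \<Rightarrow> complex" where
  "xi i = cis (2 * pi / 3 * (real i - 1)) * Complex 0 (- 2 * sqrt 3)"

definition grid_line :: "nat \<Rightarrow> int \<Rightarrow> complex set" where
  "grid_line i n = {x. x \<bullet> xi i = 3 * of_int n + 1}"

definition grid :: "complex set" where
  "grid = (\<Union>i\<in>{1,2,3}. \<Union>n. grid_line i n)"

text \<open>\<open>Tri c m\<close> stands for the triangle \<open>c + m T\<^sub>0\<close>: the regular triangle with a horizontal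
  side, center \<open>c\<close> and side length \<open>\<bar>m\<bar>\<close>, positive iff \<open>m > 0\<close> and negative iff \<open>m < 0\<close>.
  Since \<open>norm (xi i) = 2 * sqrt 3\<close>, the vertices of \<open>Tri 0 1\<close> lie at distance \<open>1 / sqrt 3\<close> from the
  origin, vertex 1 straight above it. Vertex \<open>i\<close> is opposite to side \<open>i\<close>, which lies on the
  line \<open>(x - c) \<bullet> xi i = m\<close>.\<close>

datatype triangle = Tri (tri_center: complex) (tri_ratio: int)

definition vertex :: "triangle \<Rightarrow> nat \<Rightarrow> complex" where
  "vertex t i = tri_center t - (of_int (tri_ratio t) / 6) *\<^sub>R xi i"

definition tri_points :: "triangle \<Rightarrow> complex set" where
  "tri_points t = convex hull {vertex t 1, vertex t 2, vertex t 3}"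

definition side :: "triangle \<Rightarrow> nat \<Rightarrow> complex set" where
  "side t i = closed_segment (vertex t (i + 1)) (vertex t (i + 2))"

definition sides :: "triangle \<Rightarrow> complex set set" where
  "sides t = side t ` {1,2,3}"

definition midsegment :: "triangle \<Rightarrow> nat \<Rightarrow> complex set" where
  "midsegment t i = closed_segment (midpoint (vertex t i) (vertex t (i + 1)))
                                   (midpoint (vertex t i) (vertex t (i + 2)))"

definition midsegments :: "triangle \<Rightarrow> complex set set" where
  "midsegments t = midsegment t ` {1,2,3}"

abbreviation T0 :: triangle where
  "T0 \<equiv> Tri 0 1"

definition unit_triangles_of :: "complex set \<Rightarrow> triangle set" where
  "unit_triangles_of G = {t. \<bar>tri_ratio t\<bar> = 1 \<and> (\<forall>s\<in>sides t. s \<subseteq> G)}"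

definition grid_triangles :: "triangle set" where
  "grid_triangles = unit_triangles_of grid"

definition grid_edges :: "complex set set" where
  "grid_edges = (\<Union>t\<in>grid_triangles. sides t)"


section \<open>Folding patterns\<close>

datatype folding = Up | Down
datatype color = Red | Blue

definition reflect :: "nat \<Rightarrow> real \<Rightarrow> complex \<Rightarrow> complex" where
  "reflect i s x = x - (2 * (x \<bullet> xi i - s) / (xi i \<bullet> xi i)) *\<^sub>R xi i"

text \<open>The flat effect of the elementary folding of \<open>(-2)\<^bsup>k+1\<^esup> T\<^sub>0\<close> onto its central triangle
  \<open>(-2)\<^bsup>k\<^esup> T\<^sub>0\<close>: each of the three corners is reflected in the midsegment cutting it off, which
  lies on \<open>x \<bullet> xi i = (-2)\<^bsup>k\<^esup>\<close>.\<close>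

definition fold_onto :: "nat \<Rightarrow> complex \<Rightarrow> complex" where
  "fold_onto k x =
     (let s = (-2) ^ k in
      if x \<bullet> xi 1 / s > 1 then reflect 1 s x
      else if x \<bullet> xi 2 / s > 1 then reflect 2 s x
      else if x \<bullet> xi 3 / s > 1 then reflect 3 s x
      else x)"

text \<open>\<open>crease_color a k up e\<close> follows a unit edge of the paper through the foldings
  \<open>a k, a (k - 1), \<dots>, a 1\<close>. Here \<open>e\<close> is its current position inside \<open>(-2)\<^bsup>k\<^esup> T\<^sub>0\<close>, and \<open>up\<close>
  tells whether the layer containing it currently has its original upper face on top. A layer that
  is turned over is creased the other way: a folding up produces a valley in the layers with \<open>up\<close>
  and, seen from the original upper face, a peak in the others. Folding turns over exactly the
  layers in the three corners. An edge that is never folded (it lies on the boundary of the paper)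
  has no color.\<close>

fun crease_color :: "(nat \<Rightarrow> folding) \<Rightarrow> nat \<Rightarrow> bool \<Rightarrow> complex set \<Rightarrow> color option" where
  "crease_color a 0 up e = None"
| "crease_color a (Suc k) up e =
     (if \<exists>s\<in>midsegments (Tri 0 ((-2) ^ Suc k)). e \<subseteq> s
      then Some (if (a (Suc k) = Up) = up then Red else Blue)
      else crease_color a k
             (if e \<subseteq> tri_points (Tri 0 ((-2) ^ k)) then up else \<not> up)
             (fold_onto k ` e))"

text \<open>The pattern on \<open>(-2)\<^bsup>k\<^esup> T\<^sub>0\<close> of the finite sequence \<open>a 1, \<dots>, a k\<close>.\<close>

definition finite_pattern :: "(nat \<Rightarrow> folding) \<Rightarrow> nat \<Rightarrow> complex set \<Rightarrow> color option" where
  "finite_pattern a k e = crease_color a k True e"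

definition edge_interior_to :: "complex set \<Rightarrow> triangle \<Rightarrow> bool" where
  "edge_interior_to e t \<longleftrightarrow> e \<subseteq> tri_points t \<and> \<not> e \<subseteq> frontier (tri_points t)"

definition folding_pattern :: "(nat \<Rightarrow> folding) \<Rightarrow> complex set \<Rightarrow> color option" where
  "folding_pattern a e =
     (if e \<in> grid_edges
      then Some (THE c. \<forall>k. edge_interior_to e (Tri 0 ((-2) ^ k)) \<longrightarrow> finite_pattern a k e = Some c)
      else None)"


section \<open>Edge-colored triangles and the substitutions \<open>F\<^sub>+\<close> and \<open>F\<^sub>P\<close>\<close>

text \<open>Lines parallel to the sides of \<open>Tri c m\<close> at distance \<open>sqrt 3 / 2\<close> (the height of a unit
  triangle) from one another, the lines of the sides among them.\<close>

definition subdivision_grid :: "triangle \<Rightarrow> complex set" where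
  "subdivision_grid t =
     {x. \<exists>i\<in>{1,2,3}. \<exists>n::int. (x - tri_center t) \<bullet> xi i = of_int (tri_ratio t + 3 * n)}"

definition unit_triangles :: "triangle \<Rightarrow> triangle set" where
  "unit_triangles t =
     {u \<in> unit_triangles_of (subdivision_grid t). tri_points u \<subseteq> tri_points t}"

definition unit_edges :: "triangle \<Rightarrow> complex set set" where
  "unit_edges t = (\<Union>u\<in>unit_triangles t. sides u)"

text \<open>The domain of the coloring is meant to be the set of unit edges of the triangle.\<close>

datatype colored_triangle = CTri (shape: triangle) (coloring: "complex set \<Rightarrow> color option")

fun opposite :: "color \<Rightarrow> color" where
  "opposite Red = Blue"
| "opposite Blue = Red"

definition homothety :: "complex \<Rightarrow> int \<Rightarrow> complex \<Rightarrow> complex" where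
  "homothety p r x = p + of_int r *\<^sub>R (x - p)"

definition homothety_tri :: "complex \<Rightarrow> int \<Rightarrow> triangle \<Rightarrow> triangle" where
  "homothety_tri p r t = Tri (homothety p r (tri_center t)) (r * tri_ratio t)"

definition F_plus :: "colored_triangle \<Rightarrow> colored_triangle" where
  "F_plus D =
     (let t = shape D; p = tri_center t; t' = homothety_tri p 2 t in
      CTri t' (\<lambda>e'.
        if e' \<in> unit_edges t' \<and> (\<exists>e\<in>unit_edges t. e' \<subseteq> homothety p 2 ` e)
        then map_option opposite (coloring D (THE e. e \<in> unit_edges t \<and> e' \<subseteq> homothety p 2 ` e))
        else if \<exists>u\<in>unit_triangles t. tri_ratio u > 0 \<and> e' \<in> midsegments (homothety_tri p 2 u)
        then Some Blue
        else if \<exists>u\<in>unit_triangles t. tri_ratio u < 0 \<and> e' \<in> midsegments (homothety_tri p 2 u)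
        then Some Red
        else None))"

definition F_P :: "colored_triangle \<Rightarrow> colored_triangle" where
  "F_P = F_plus \<circ> F_plus"

definition seed :: colored_triangle where
  "seed = CTri T0 (\<lambda>e. if e \<in> sides T0 then Some Red else None)"

definition generates_pattern ::
  "(colored_triangle \<Rightarrow> colored_triangle) \<Rightarrow> colored_triangle \<Rightarrow> (complex set \<Rightarrow> color option) \<Rightarrow> bool"
where
  "generates_pattern F D P \<longleftrightarrow>
     (\<forall>e c. P e = Some c \<longleftrightarrow> (\<exists>N. \<forall>n\<ge>N. coloring ((F ^^ n) D) e = Some c))"


section \<open>Decorated tiles and the tile substitution \<open>F\<^sub>T\<close>\<close>

text \<open>A placed unit tile (whose orientation is the sign of its ratio), its number of red sides and,
  if this number is 1 or 2, the index \<open>i \<in> {1,2,3}\<close> of the side whose color differs from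
  the other two.\<close>

datatype tile = Tile (tile_triangle: triangle) (red_count: nat) (mark: "nat option")

definition decorate :: "(complex set \<Rightarrow> color option) \<Rightarrow> triangle \<Rightarrow> tile" where
  "decorate P t =
     (let r = card {i \<in> {1,2,3}. P (side t i) = Some Red} in
      Tile t r
        (if r = 1 then Some (THE i. i \<in> {1,2,3} \<and> P (side t i) = Some Red)
         else if r = 2 then Some (THE i. i \<in> {1,2,3} \<and> P (side t i) = Some Blue)
         else None))"

definition folding_tiling :: "(nat \<Rightarrow> folding) \<Rightarrow> tile set" where
  "folding_tiling a = decorate (folding_pattern a) ` grid_triangles"

definition marked_side :: "tile \<Rightarrow> complex set \<Rightarrow> bool" where
  "marked_side w e \<longleftrightarrow> (\<exists>i\<in>{1,2,3}. mark w = Some i \<and> e = side (tile_triangle w) i)"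

definition colored_of_tile :: "tile \<Rightarrow> colored_triangle" where
  "colored_of_tile w =
     CTri (tile_triangle w) (\<lambda>e.
       if e \<notin> sides (tile_triangle w) then None
       else if red_count w = 0 then Some Blue
       else if red_count w = 1 then Some (if marked_side w e then Red else Blue)
       else if red_count w = 2 then Some (if marked_side w e then Blue else Red)
       else Some Red)"

definition tiles_of :: "colored_triangle \<Rightarrow> tile set" where
  "tiles_of D = decorate (coloring D) ` unit_triangles (shape D)"

definition substitute_tile :: "tile \<Rightarrow> tile set" where
  "substitute_tile w = tiles_of (F_P (colored_of_tile w))"

text \<open>\<open>substitute_tile\<close> keeps the center of the tile. On a set of tiles the plane is inflated by the
  factor 4 about the origin, so the supertile of a tile with center \<open>c\<close> has center \<open>4 c\<close>.\<close>

definition recenter :: "tile \<Rightarrow> tile" where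
  "recenter w = Tile (Tri (4 * tri_center (tile_triangle w)) (tri_ratio (tile_triangle w)))
                     (red_count w) (mark w)"

definition F_T :: "tile set \<Rightarrow> tile set" where
  "F_T W = (\<Union>w\<in>W. substitute_tile (recenter w))"

definition generates_tiling :: "(tile set \<Rightarrow> tile set) \<Rightarrow> tile set \<Rightarrow> tile set \<Rightarrow> bool" where
  "generates_tiling F W T \<longleftrightarrow>
     (\<forall>n. (F ^^ n) W \<subseteq> T) \<and> (\<forall>w\<in>T. \<exists>N. \<forall>n\<ge>N. w \<in> (F ^^ n) W)"

end

theory Submission
  imports Defs
begin

text \<open>Folding the paper \<open>(-2)\<^bsup>k+1\<^esup> T\<^sub>0\<close> is folding \<open>(-2)\<^bsup>k\<^esup> T\<^sub>0\<close> seen through the homothety of ratio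
  \<open>-2\<close>, so all foldings being equal, the limit pattern \<open>P\<close> is invariant under inflation
    by \<open>-2\<close>: both
  halves of \<open>-2 e\<close> have the color of \<open>e\<close>. The remaining edges are the midsegments of the triangles
  \<open>-2 U\<close> with \<open>U\<close> a unit triangle; such an edge is creased at the last folding, and since every
  reflection turns the paper over and reverses the orientation of \<open>U\<close>, it is red
    iff \<open>U\<close> is positive.
  Comparing this with the rule \<open>F\<^sub>+\<close>, which inflates by \<open>2\<close>, one sees that \<open>F\<^sub>+\<close> turns \<open>P\<close> into its
  rotation by \<open>\<pi>\<close> with the colors exchanged. As \<open>F\<^sub>+\<close> commutes with this operation, which is an
  involution, \<open>F\<^sub>P = F\<^sub>+ \<circ> F\<^sub>+\<close> fixes \<open>P\<close>.

  Since folding and inflation act pointwise, an edge is represented by a point of its relative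
  interior. In the coordinates \<open>((x, \<xi>\<^sub>i) - 1) / 3\<close>, which sum to \<open>-1\<close>, the grid consists of the
    points
  having an integral coordinate, and the cell containing a point is read off from the floors and
  ceilings of its coordinates.\<close>

subsection \<open>Coordinates\<close>

text \<open>The inflation by \<open>- 2\<close> about the origin maps the grid into itself because
  \<open>- 2\<close> is \<open>1\<close> modulo \<open>3\<close>; the inflation by \<open>2\<close>
  does not. Hence \<open>F_plus\<close> is compared with the pattern only after the colored triangle
  has been placed in the plane by a map \<open>x \<mapsto> w + s x\<close> with \<open>s = 1\<close>
  or \<open>s = - 1\<close>. One application of \<open>F_plus\<close> replaces \<open>s\<close> by
  \<open>- s\<close> and inflates the placed triangle by \<open>- 2\<close> about the origin, and
  the exchange of colors is tied to the sign \<open>s\<close>. The shift \<open>w\<close> is left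
  arbitrary for the sake of the tiles, whose supertiles are centered away from the origin.

  Colors are defined on whole edges, and the folding map is only piecewise a reflection. The passage
  to points works because every fold line is a grid line, so no fold cuts through a cell. A color
  found at one level persists at all higher levels, since a point strictly inside one paper triangle
  stays in the central, unmoved part of every larger one.\<close>

declare One_nat_def [simp del]

lemma cis_two_thirds_pi: "cis (2 * pi / 3) = Complex (- 1 / 2) (sqrt 3 / 2)"
  by (simp add: complex_eq_iff cos_120 sin_120)

lemma xi_1: "xi 1 = Complex 0 (- 2 * sqrt 3)"
  by (simp add: xi_def)

lemma xi_Suc: "xi (Suc i) = Complex (- 1 / 2) (sqrt 3 / 2) * xi i"
proof -
  have "2 * pi / 3 * (real (Suc i) - 1) = 2 * pi / 3 + 2 * pi / 3 * (real i - 1)"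
    by (simp add: field_simps)
  then show ?thesis
    unfolding xi_def cis_two_thirds_pi[symmetric] by (simp only: cis_mult[symmetric] mult.assoc)
qed

lemma xi_2: "xi 2 = Complex 3 (sqrt 3)"
  and xi_3: "xi 3 = Complex (- 3) (sqrt 3)"
  and xi_4: "xi 4 = xi 1"
  and xi_5: "xi 5 = xi 2"
  by (simp_all add: numeral_eq_Suc xi_Suc[of "Suc _"] xi_1[unfolded One_nat_def] One_nat_def
    complex_eq_iff)

lemmas xi_simps = xi_1 xi_2 xi_3 xi_4 xi_5

definition coord :: "nat \<Rightarrow> complex \<Rightarrow> real" where
  "coord i x = (x \<bullet> xi i - 1) / 3"

text \<open>The three normals sum to zero, so only the three offsets \<open>- 1 / 3\<close>
  survive.\<close>

lemma coord_sum: "coord 1 x + coord 2 x + coord 3 x = - 1"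
  by (simp add: coord_def xi_simps inner_complex_def field_simps)

lemma coord_eqI:
  assumes "\<And>i. i \<in> {1,2,3} \<Longrightarrow> coord i x = coord i y"
  shows "x = y"
  using assms[of 1] assms[of 2]
  by (auto simp: coord_def xi_simps inner_complex_def complex_eq_iff)

lemma coord_exists:
  assumes "a + b + c = - 1"
  obtains x where "coord 1 x = a" "coord 2 x = b" "coord 3 x = c"
proof
  let ?x = "Complex ((b - c) / 2) (- (3 * a + 1) * sqrt 3 / 6)"
  show "coord 1 ?x = a" "coord 2 ?x = b" "coord 3 ?x = c"
    using assms by (auto simp: coord_def xi_simps inner_complex_def field_simps)
qed

lemma coord_scale: "coord i (r *\<^sub>R x) = r * coord i x + (r - 1) / 3"
  by (simp add: coord_def field_simps)

text \<open>Coordinate \<open>i\<close> takes the same value at the two vertices other than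
  \<open>i\<close>, so it depends only on the weight of vertex \<open>i\<close>.\<close>

lemma coord_barycentric:
  assumes "x = u *\<^sub>R vertex (Tri c m) 1 + v *\<^sub>R vertex (Tri c m) 2 + w *\<^sub>R vertex (Tri c m) 3"
    and "u + v + w = 1"
  shows "coord 1 x = coord 1 c + m * (1 / 3 - u)"
    and "coord 2 x = coord 2 c + m * (1 / 3 - v)"
    and "coord 3 x = coord 3 c + m * (1 / 3 - w)"
proof -
  have x: "x = c - (m / 6) *\<^sub>R (u *\<^sub>R xi 1 + v *\<^sub>R xi 2 + w *\<^sub>R xi 3)"
  proof -
    have "c = (u + v + w) *\<^sub>R c" using assms by simp
    then show ?thesis unfolding assms(1) vertex_def by (simp add: algebra_simps)
  qed
  have u: "u = 1 - v - w" using assms by simp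
  show "coord 1 x = coord 1 c + m * (1 / 3 - u)"
    and "coord 2 x = coord 2 c + m * (1 / 3 - v)"
    and "coord 3 x = coord 3 c + m * (1 / 3 - w)"
    unfolding x u coord_def xi_simps inner_complex_def by (simp_all add: field_simps)
qed

text \<open>Solving \<open>coord_barycentric\<close> for the weights; nonnegativity of the weights
  then becomes one linear inequality per coordinate.\<close>

lemma barycentric_coord:
  fixes x c :: complex and m :: int
  assumes "m \<noteq> 0"
  defines "w \<equiv> \<lambda>i. 1 / 3 - (coord i x - coord i c) / m"
  shows "x = w 1 *\<^sub>R vertex (Tri c m) 1 + w 2 *\<^sub>R vertex (Tri c m) 2 + w 3 *\<^sub>R vertex (Tri c m) 3"
    and "w 1 + w 2 + w 3 = 1"
proof -
  show "x = w 1 *\<^sub>R vertex (Tri c m) 1 + w 2 *\<^sub>R vertex (Tri c m) 2 + w 3 *\<^sub>R vertex (Tri c m) 3"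
    using assms(1)
    by (simp add: w_def vertex_def coord_def xi_simps inner_complex_def complex_eq_iff field_simps)
  have "w 1 + w 2 + w 3
      = 1 - ((coord 1 x + coord 2 x + coord 3 x) - (coord 1 c + coord 2 c + coord 3 c)) / m"
    by (simp add: w_def diff_divide_distrib add_divide_distrib)
  then show "w 1 + w 2 + w 3 = 1"
    by (simp add: coord_sum)
qed

lemma mem_tri_points_iff:
  assumes "m \<noteq> 0"
  shows "x \<in> tri_points (Tri c m) \<longleftrightarrow> (\<forall>i\<in>{1,2,3}. (coord i x - coord i c) / m \<le> 1 / 3)"
proof
  assume "x \<in> tri_points (Tri c m)"
  then obtain u v w where *: "0 \<le> u" "0 \<le> v" "0 \<le> w" "u + v + w = 1"
    and x: "x = u *\<^sub>R vertex (Tri c m) 1 + v *\<^sub>R vertex (Tri c m) 2 + w *\<^sub>R vertex (Tri c m) 3"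
    unfolding tri_points_def convex_hull_3 by blast
  show "\<forall>i\<in>{1,2,3}. (coord i x - coord i c) / m \<le> 1 / 3"
    using * coord_barycentric[OF x *(4)] assms by simp
next
  assume *: "\<forall>i\<in>{1,2,3}. (coord i x - coord i c) / m \<le> 1 / 3"
  define w where "w i = 1 / 3 - (coord i x - coord i c) / m" for i
  have "x = w 1 *\<^sub>R vertex (Tri c m) 1 + w 2 *\<^sub>R vertex (Tri c m) 2 + w 3 *\<^sub>R vertex (Tri c m) 3"
    "w 1 + w 2 + w 3 = 1"
    unfolding w_def using barycentric_coord[OF assms, of x c] by simp_all
  moreover have "0 \<le> w 1" "0 \<le> w 2" "0 \<le> w 3"
    using * by (simp_all add: w_def)
  ultimately show "x \<in> tri_points (Tri c m)"
    unfolding tri_points_def convex_hull_3 by blast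
qed

text \<open>Side \<open>i\<close> is the part of the triangle where the weight of the opposite
  vertex \<open>i\<close> vanishes.\<close>

lemma mem_side_iff:
  assumes "m \<noteq> 0" "i \<in> {1,2,3}"
  shows "x \<in> side (Tri c m) i \<longleftrightarrow> x \<in> tri_points (Tri c m) \<and> coord i x = coord i c + m / 3"
proof
  have v: "vertex t 4 = vertex t 1" "vertex t 5 = vertex t 2" for t
    by (simp_all add: vertex_def xi_4 xi_5)
  {
    assume "x \<in> side (Tri c m) i"
    then obtain s where s: "0 \<le> s" "s \<le> 1"
      and x: "x = (1 - s) *\<^sub>R vertex (Tri c m) (i + 1) + s *\<^sub>R vertex (Tri c m) (i + 2)"
      unfolding side_def closed_segment_def by blast
    consider "x = 0 *\<^sub>R vertex (Tri c m) 1 + (1 - s) *\<^sub>R vertex (Tri c m) 2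
      + s *\<^sub>R vertex (Tri c m) 3" "i = 1"
      | "x = s *\<^sub>R vertex (Tri c m) 1 + 0 *\<^sub>R vertex (Tri c m) 2 + (1 - s) *\<^sub>R vertex (Tri c m) 3"
        "i = 2"
      | "x = (1 - s) *\<^sub>R vertex (Tri c m) 1 + s *\<^sub>R vertex (Tri c m) 2 + 0 *\<^sub>R vertex (Tri c m) 3"
        "i = 3"
      using x assms(2) by (auto simp: v add.commute)
    then show "x \<in> tri_points (Tri c m) \<and> coord i x = coord i c + m / 3"
    proof cases
      case 1
      from coord_barycentric[OF 1(1)] show ?thesis
        using s \<open>i = 1\<close> assms(1) by (simp add: mem_tri_points_iff[OF assms(1)])
    next
      case 2
      from coord_barycentric[OF 2(1)] show ?thesis
        using s \<open>i = 2\<close> assms(1) by (simp add: mem_tri_points_iff[OF assms(1)])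
    next
      case 3
      from coord_barycentric[OF 3(1)] show ?thesis
        using s \<open>i = 3\<close> assms(1) by (simp add: mem_tri_points_iff[OF assms(1)])
    qed
  next
    assume x: "x \<in> tri_points (Tri c m) \<and> coord i x = coord i c + m / 3"
    define w where "w i = 1 / 3 - (coord i x - coord i c) / m" for i
    have w: "x = w 1 *\<^sub>R vertex (Tri c m) 1 + w 2 *\<^sub>R vertex (Tri c m) 2
      + w 3 *\<^sub>R vertex (Tri c m) 3"
      "w 1 + w 2 + w 3 = 1" "0 \<le> w 1" "0 \<le> w 2" "0 \<le> w 3"
      using barycentric_coord[OF assms(1), of x c] x mem_tri_points_iff[OF assms(1)]
      by (simp_all add: w_def)
    have "w i = 0" using x assms(1) by (simp add: w_def)
    then consider "i = 1" "w 1 = 0" | "i = 2" "w 2 = 0" | "i = 3" "w 3 = 0"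
      using assms(2) by auto
    then show "x \<in> side (Tri c m) i"
    proof cases
      case 1
      \<comment> \<open>The segment runs from vertex \<open>i + 1\<close> to vertex
        \<open>i + 2\<close>, so its parameter is the weight of vertex \<open>i + 2\<close>, read
        cyclically: \<open>w 3\<close>, \<open>w 1\<close> and \<open>w 2\<close> in the three
        cases.\<close>
      then show ?thesis using w unfolding side_def closed_segment_def
        by (auto simp: v add.commute intro!: exI[of _ "w 3"])
    next
      case 2
      then show ?thesis using w unfolding side_def closed_segment_def
        by (auto simp: v add.commute intro!: exI[of _ "w 1"])
    next
      case 3
      then show ?thesis using w unfolding side_def closed_segment_def
        by (auto simp: v add.commute intro!: exI[of _ "w 2"])
    qed
  }
qed

text \<open>The medial triangle is the image under the homothety of ratio \<open>- 1 / 2\<close>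
  about the common center.\<close>

lemma midsegments_eq_sides: "midsegments (Tri c (- 2 * m)) = sides (Tri c m)"
proof -
  have "midsegment (Tri c (- 2 * m)) i = side (Tri c m) i" if "i \<in> {1,2,3}" for i
  proof -
    have "midpoint (vertex (Tri c (- 2 * m)) i) (vertex (Tri c (- 2 * m)) (i + 1))
      = vertex (Tri c m) (i + 2)"
      "midpoint (vertex (Tri c (- 2 * m)) i) (vertex (Tri c (- 2 * m)) (i + 2))
        = vertex (Tri c m) (i + 1)"
      using that by (auto simp: midpoint_def vertex_def xi_simps complex_eq_iff field_simps)
    then show ?thesis
      by (simp add: midsegment_def side_def closed_segment_commute)
  qed
  then show ?thesis
    unfolding midsegments_def sides_def by (intro image_cong) auto
qed

subsection \<open>Affine maps\<close>

text \<open>One form for the inflations by \<open>- 2\<close> and \<open>4\<close> about the origin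
  and for the placements of ratio \<open>1\<close> or \<open>- 1\<close>; such maps with nonzero
  ratio keep horizontal sides horizontal.\<close>

definition aff :: "int \<Rightarrow> complex \<Rightarrow> complex \<Rightarrow> complex" where
  "aff r w x = w + of_int r *\<^sub>R x"

definition aff_tri :: "int \<Rightarrow> complex \<Rightarrow> triangle \<Rightarrow> triangle" where
  "aff_tri r w t = Tri (aff r w (tri_center t)) (r * tri_ratio t)"

lemma aff_tri_simps [simp]:
  "tri_center (aff_tri r w t) = aff r w (tri_center t)"
  "tri_ratio (aff_tri r w t) = r * tri_ratio t"
  by (simp_all add: aff_tri_def)

lemma aff_aff: "aff r w (aff s v x) = aff (r * s) (aff r w v) x"
  by (simp add: aff_def algebra_simps)

lemma aff_tri_aff_tri: "aff_tri r w (aff_tri s v t) = aff_tri (r * s) (aff r w v) t"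
  by (simp add: aff_tri_def aff_aff)

lemma aff_1_0 [simp]: "aff 1 0 x = x"
  by (simp add: aff_def)

lemma aff_tri_1_0 [simp]: "aff_tri 1 0 t = t"
  by (simp add: aff_tri_def)

lemma aff_0: "aff r 0 x = of_int r *\<^sub>R x"
  by (simp add: aff_def)

lemma inj_aff: "r \<noteq> 0 \<Longrightarrow> inj (aff r w)"
  by (simp add: inj_on_def aff_def)

lemma vertex_aff_tri: "vertex (aff_tri r w t) i = aff r w (vertex t i)"
  by (simp add: vertex_def aff_def algebra_simps)

lemma tri_points_aff_tri: "tri_points (aff_tri r w t) = aff r w ` tri_points t"
proof -
  have "aff r w = (\<lambda>x. w + of_int r *\<^sub>R x)"
    by (rule ext) (simp add: aff_def)
  then show ?thesis
    using convex_hull_affinity[of w "of_int r" "{vertex t 1, vertex t 2, vertex t 3}"]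
    by (simp add: tri_points_def vertex_aff_tri)
qed

lemma closed_segment_aff: "closed_segment (aff r w x) (aff r w y) = aff r w ` closed_segment x y"
proof -
  have "aff r w = (\<lambda>x. w + of_int r *\<^sub>R x)"
    by (rule ext) (simp add: aff_def)
  then show ?thesis
    using convex_hull_affinity[of w "of_int r" "{x, y}"] by (simp add: segment_convex_hull)
qed

lemma side_aff_tri: "side (aff_tri r w t) i = aff r w ` side t i"
  by (simp add: side_def vertex_aff_tri closed_segment_aff)

lemma sides_aff_tri: "sides (aff_tri r w t) = (`) (aff r w) ` sides t"
  by (simp add: sides_def side_aff_tri)

lemma midpoint_aff: "midpoint (aff r w x) (aff r w y) = aff r w (midpoint x y)"
  by (simp add: midpoint_def aff_def complex_eq_iff field_simps)

lemma midsegments_aff_tri: "midsegments (aff_tri r w t) = (`) (aff r w) ` midsegments t"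
  by (simp add: midsegments_def midsegment_def vertex_aff_tri closed_segment_aff midpoint_aff)

text \<open>The subdivision grid is defined relative to its triangle and moves along with it; ratios
  of absolute value \<open>1\<close> keep unit triangles unit.\<close>

lemma aff_tri_unit_triangles:
  assumes "u \<in> unit_triangles t" "s = 1 \<or> s = - 1"
  shows "aff_tri s w u \<in> unit_triangles (aff_tri s w t)"
proof -
  have "aff s w ` subdivision_grid t \<subseteq> subdivision_grid (aff_tri s w t)"
  proof clarify
    fix x assume "x \<in> subdivision_grid t"
    then obtain i n where i: "i \<in> {1,2,3}"
      and n: "(x - tri_center t) \<bullet> xi i = of_int (tri_ratio t + 3 * n)"
      unfolding subdivision_grid_def by blast
    have "(aff s w x - tri_center (aff_tri s w t)) \<bullet> xi i = of_int s * ((x - tri_center t) \<bullet> xi i)"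
      by (simp add: aff_def algebra_simps)
    also have "\<dots> = of_int (tri_ratio (aff_tri s w t) + 3 * (s * n))"
      unfolding n by (simp add: algebra_simps)
    finally show "aff s w x \<in> subdivision_grid (aff_tri s w t)"
      unfolding subdivision_grid_def using i by blast
  qed
  moreover have "\<bar>s * tri_ratio u\<bar> = \<bar>tri_ratio u\<bar>"
    using assms(2) by auto
  ultimately show ?thesis
    using assms(1) unfolding unit_triangles_def unit_triangles_of_def
    by (fastforce simp: sides_aff_tri tri_points_aff_tri)
qed

lemma aff_inverse:
  assumes "s = 1 \<or> s = - 1"
  shows "aff s (- of_int s *\<^sub>R w) (aff s w x) = x"
    and "aff_tri s (- of_int s *\<^sub>R w) (aff_tri s w t) = t"
  using assms by (auto simp: aff_def aff_tri_def algebra_simps)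

lemma aff_tri_unit_triangles_iff:
  assumes "s = 1 \<or> s = - 1"
  shows "aff_tri s w u \<in> unit_triangles (aff_tri s w t) \<longleftrightarrow> u \<in> unit_triangles t"
  using aff_tri_unit_triangles[OF _ assms] aff_inverse(2)[OF assms] by metis

lemma aff_unit_edges:
  assumes "e \<in> unit_edges t" "s = 1 \<or> s = - 1"
  shows "aff s w ` e \<in> unit_edges (aff_tri s w t)"
  using assms(1) aff_tri_unit_triangles[OF _ assms(2)]
  unfolding unit_edges_def by (fastforce simp: sides_aff_tri)

lemma aff_unit_edges_iff:
  assumes "s = 1 \<or> s = - 1"
  shows "aff s w ` e \<in> unit_edges (aff_tri s w t) \<longleftrightarrow> e \<in> unit_edges t"
proof
  assume "aff s w ` e \<in> unit_edges (aff_tri s w t)"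
  from aff_unit_edges[OF this assms, of "- of_int s *\<^sub>R w"]
  show "e \<in> unit_edges t"
    by (simp add: aff_inverse[OF assms] image_image del: scaleR_minus_left)
qed (rule aff_unit_edges[OF _ assms])

subsection \<open>Cells of the grid\<close>

lemma mem_grid_iff: "x \<in> grid \<longleftrightarrow> (\<exists>i\<in>{1,2,3}. coord i x \<in> \<int>)"
proof -
  have "(\<exists>n. x \<in> grid_line i n) \<longleftrightarrow> coord i x \<in> \<int>" for i
    by (auto simp: grid_line_def coord_def Ints_def image_iff field_simps)
  then show ?thesis
    by (simp add: grid_def)
qed

text \<open>By \<open>mem_side_iff\<close> the number in question is the constant value of
  coordinate \<open>i\<close> on side \<open>i\<close>, so the condition says that the sides lie on
  lines of the grid.\<close>

definition aligned :: "triangle \<Rightarrow> bool" where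
  "aligned t \<longleftrightarrow> (\<forall>i\<in>{1,2,3}. coord i (tri_center t) + tri_ratio t / 3 \<in> \<int>)"

text \<open>\<open>N i\<close> is the index of the grid line carrying side \<open>i\<close>. The
  indices sum to \<open>m - 1\<close> because the coordinates of the center sum to
  \<open>- 1\<close>.\<close>

lemma alignedE:
  assumes "aligned (Tri c m)"
  obtains N :: "nat \<Rightarrow> int" where "\<And>i. i \<in> {1,2,3} \<Longrightarrow> coord i c = N i - m / 3" "N 1 + N 2 + N 3
    = m - 1"
proof
  define N where "N i = \<lfloor>coord i c + m / 3\<rfloor>" for i
  show N: "coord i c = N i - m / 3" if "i \<in> {1,2,3}" for i
    using assms that by (auto simp: aligned_def N_def elim!: Ints_cases)
  have "real_of_int (N 1 + N 2 + N 3) = of_int (m - 1)"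
    using coord_sum[of c] N[of 1] N[of 2] N[of 3] by simp
  then show "N 1 + N 2 + N 3 = m - 1"
    by linarith
qed

lemma alignedI:
  assumes "\<And>i. i \<in> {1,2,3} \<Longrightarrow> coord i c = of_int (N i) - m / 3"
  shows "aligned (Tri c m)"
  using assms by (simp add: aligned_def)

lemma mem_tri_points_pos:
  assumes "m > 0"
  shows "x \<in> tri_points (Tri c m) \<longleftrightarrow> (\<forall>i\<in>{1,2,3}. coord i x \<le> coord i c + m / 3)"
  using assms by (simp add: mem_tri_points_iff field_simps)

lemma mem_tri_points_neg:
  assumes "m < 0"
  shows "x \<in> tri_points (Tri c m) \<longleftrightarrow> (\<forall>i\<in>{1,2,3}. coord i c + m / 3 \<le> coord i x)"
  using assms by (simp add: mem_tri_points_iff field_simps)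

text \<open>The cell of \<open>x\<close> is the vertex, edge or triangle of the grid having \<open>x\<close> in its relative
  interior.\<close>

definition cell :: "complex \<Rightarrow> complex set" where
  "cell x = {y. \<forall>i\<in>{1,2,3}. of_int \<lfloor>coord i x\<rfloor> \<le> coord i y \<and> coord i y \<le> of_int \<lceil>coord i x\<rceil>}"

lemma mem_cell_self: "x \<in> cell x"
  by (simp add: cell_def)

text \<open>An aligned triangle is cut out by integer bounds on the coordinates, and an integer
  bound on \<open>coord i x\<close> also bounds its ceiling or its floor.\<close>

lemma cell_subset_tri_points:
  assumes "aligned t" "tri_ratio t \<noteq> 0" "x \<in> tri_points t"
  shows "cell x \<subseteq> tri_points t"
proof -
  obtain c m where t: "t = Tri c m" by (cases t)
  from assms(1) obtain N where N: "\<And>i. i \<in> {1,2,3} \<Longrightarrow> coord i c = of_int (N i) - m / 3"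
    and "N 1 + N 2 + N 3 = m - 1"
    unfolding t by (rule alignedE) blast
  consider "m > 0" | "m < 0" using assms(2) t by fastforce
  then show ?thesis
  proof cases
    case 1
    have "coord i y \<le> N i" if "y \<in> cell x" "i \<in> {1,2,3}" for y i
    proof -
      have "coord i x \<le> N i"
        using assms(3) that(2) N[OF that(2)] unfolding t mem_tri_points_pos[OF 1] by auto
      then have "\<lceil>coord i x\<rceil> \<le> N i"
        by (simp add: ceiling_le_iff)
      moreover have "coord i y \<le> \<lceil>coord i x\<rceil>"
        using that by (auto simp: cell_def)
      ultimately show ?thesis by linarith
    qed
    then show ?thesis
      unfolding t using N by (auto simp: mem_tri_points_pos[OF 1])
  next
    case 2
    have "N i \<le> coord i y" if "y \<in> cell x" "i \<in> {1,2,3}" for y i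
    proof -
      have "N i \<le> coord i x"
        using assms(3) that(2) N[OF that(2)] unfolding t mem_tri_points_neg[OF 2] by auto
      then have "N i \<le> \<lfloor>coord i x\<rfloor>"
        by (simp add: le_floor_iff)
      moreover have "\<lfloor>coord i x\<rfloor> \<le> coord i y"
        using that by (auto simp: cell_def)
      ultimately show ?thesis by linarith
    qed
    then show ?thesis
      unfolding t using N by (auto simp: mem_tri_points_neg[OF 2])
  qed
qed

text \<open>On side \<open>i\<close> the coordinate \<open>i\<close> is an integer, so floor and
  ceiling pin it down on the whole cell.\<close>

lemma cell_subset_side:
  assumes "aligned t" "tri_ratio t \<noteq> 0" "i \<in> {1,2,3}" "x \<in> side t i"
  shows "cell x \<subseteq> side t i"
proof
  fix y assume y: "y \<in> cell x"
  obtain c m where t: "t = Tri c m" by (cases t)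
  from assms(1) obtain N where N: "\<And>i. i \<in> {1,2,3} \<Longrightarrow> coord i c = of_int (N i) - m / 3"
    and "N 1 + N 2 + N 3 = m - 1"
    unfolding t by (rule alignedE) blast
  have m: "m \<noteq> 0" using assms(2) t by simp
  have x: "x \<in> tri_points t" "coord i x = N i"
    using assms(3,4) N[OF assms(3)] unfolding t mem_side_iff[OF m assms(3)] by auto
  then have "coord i y = N i"
    using y assms(3) unfolding cell_def by force
  moreover have "y \<in> tri_points t"
    using cell_subset_tri_points[OF assms(1,2) x(1)] y by blast
  ultimately show "y \<in> side t i"
    using N[OF assms(3)] unfolding t mem_side_iff[OF m assms(3)] by auto
qed

lemma subdivision_grid_aligned:
  assumes "aligned t"
  shows "subdivision_grid t = grid"
proof -
  obtain c m where t: "t = Tri c m" by (cases t)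
  from assms obtain N where N: "\<And>i. i \<in> {1,2,3} \<Longrightarrow> coord i c = of_int (N i) - m / 3"
    and "N 1 + N 2 + N 3 = m - 1"
    unfolding t by (rule alignedE) blast
  have "(\<exists>n::int. (x - c) \<bullet> xi i = of_int (m + 3 * n)) \<longleftrightarrow> coord i x \<in> \<int>"
    if i: "i \<in> {1,2,3}" for x i
  proof -
    have "(x - c) \<bullet> xi i = 3 * (coord i x - N i) + m"
      using N[OF i] by (simp add: coord_def inner_diff_left field_simps)
    then have "(x - c) \<bullet> xi i = of_int (m + 3 * n) \<longleftrightarrow> coord i x = of_int (n + N i)" for n
      by auto
    then have "(\<exists>n::int. (x - c) \<bullet> xi i = of_int (m + 3 * n)) \<longleftrightarrow> (\<exists>n::int. coord i x = of_int (n
      + N i))"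
      by blast
    also have "\<dots> \<longleftrightarrow> (\<exists>n::int. coord i x = of_int n)"
      by (metis diff_add_cancel)
    finally show ?thesis by (simp add: Ints_def image_iff)
  qed
  then show ?thesis
    unfolding subdivision_grid_def t by (auto simp: mem_grid_iff)
qed

text \<open>Among the shifts \<open>1/4\<close>, \<open>1/2\<close>, \<open>3/4\<close>, each of
  \<open>a\<close> and \<open>b\<close> becomes integral for at most one, so one of the three shifts
  is left.\<close>

lemma quarter_shift_avoids_Ints:
  fixes a b :: real
  obtains s where "0 < s" "s < 1" "a + s \<notin> \<int>" "b + s \<notin> \<int>"
proof -
  have "x \<notin> \<int>" if "0 < x" "x < 1" for x :: real
    using that by (auto elim!: Ints_cases)
  then have *: "\<not> (c + s \<in> \<int> \<and> c + t \<in> \<int>)" if "s < t" "t < s + 1" for c s t :: real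
    using that Ints_diff[of "c + t" "c + s"] by fastforce
  show ?thesis
    using that[of "1/4"] that[of "1/2"] that[of "3/4"] *[of "1/4" "1/2"] *[of "1/4" "3/4"] *[of
      "1/2" "3/4"]
    by fastforce
qed

lemma other_indicesE:
  assumes "i \<in> {1,2,3::nat}"
  obtains j k where "{i, j, k} = {1,2,3}" "i \<noteq> j" "i \<noteq> k" "j \<noteq> k"
proof -
  consider "i = 1" | "i = 2" | "i = 3"
    using assms by auto
  then show ?thesis
  proof cases
    case 1
    show ?thesis by (rule that[of 2 3]) (use 1 in auto)
  next
    case 2
    show ?thesis by (rule that[of 1 3]) (use 2 in auto)
  next
    case 3
    show ?thesis by (rule that[of 1 2]) (use 3 in auto)
  qed
qed

lemma another_index: "\<exists>j\<in>{1,2,3::nat}. i \<noteq> j \<and> l \<noteq> j"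
  by auto

lemma coord_sum_perm:
  assumes "{i, j, k} = {1,2,3}" "i \<noteq> j" "i \<noteq> k" "j \<noteq> k"
  shows "coord i x + coord j x + coord k x = - 1"
proof -
  have "coord i x + coord j x + coord k x = (\<Sum>l\<in>{i,j,k}. coord l x)"
    using assms(2-) by simp
  also have "\<dots> = - 1"
    unfolding assms(1) using coord_sum[of x] by simp
  finally show ?thesis .
qed

lemma coord_exists_perm:
  assumes "{i, j, k} = {1,2,3}" "i \<noteq> j" "i \<noteq> k" "j \<noteq> k" "a + b + c = - 1"
  obtains x where "coord i x = a" "coord j x = b" "coord k x = c"
proof -
  define f where "f l = (if l = i then a else if l = j then b else c)" for l
  have "f 1 + f 2 + f 3 = sum f {i, j, k}"
    unfolding assms(1) by simp
  also have "\<dots> = - 1"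
    using assms(2-) by (simp add: f_def)
  finally obtain x where "coord 1 x = f 1" "coord 2 x = f 2" "coord 3 x = f 3"
    by (rule coord_exists)
  then have "\<forall>l\<in>{i,j,k}. coord l x = f l"
    unfolding assms(1) by simp
  then show ?thesis
    using that[of x] assms(2-) by (simp add: f_def)
qed

text \<open>If the line of the side were no grid line, the side could meet the grid only in lines of
  the other two families. These cross it in isolated points, so some point of the side would avoid
  the grid.\<close>

lemma aligned_side_coord:
  assumes "\<bar>r\<bar> = 1" "i \<in> {1,2,3}" "side (Tri c r) i \<subseteq> grid"
  shows "coord i c + r / 3 \<in> \<int>"
proof (rule ccontr)
  assume K: "coord i c + r / 3 \<notin> \<int>"
  have r: "r = 1 \<or> r = - 1" using assms(1) by arith
  obtain j k where jk: "{i, j, k} = {1,2,3::nat}" "i \<noteq> j" "i \<noteq> k" "j \<noteq> k"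
    using assms(2) by (rule other_indicesE)
  obtain s where s: "0 < s" "s < 1" "(- r * coord j c - 1 / 3) + s \<notin> \<int>" "r * coord k c - 2 / 3
    + s \<notin> \<int>"
    by (rule quarter_shift_avoids_Ints)
  \<comment> \<open>The point of the side with weight \<open>s\<close> at vertex \<open>j\<close>
    and \<open>1 - s\<close> at vertex \<open>k\<close>.\<close>
  have "(coord i c + r / 3) + (coord j c + r * (1 / 3 - s)) + (coord k c + r * (s - 2 / 3)) = - 1"
    using coord_sum_perm[OF jk, of c] by (simp add: algebra_simps)
  then obtain x where x: "coord i x = coord i c + r / 3" "coord j x = coord j c + r * (1 / 3 - s)"
    "coord k x = coord k c + r * (s - 2 / 3)"
    by (rule coord_exists_perm[OF jk])
  have "\<forall>l\<in>{i,j,k}. (coord l x - coord l c) / r \<le> 1 / 3"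
    using x s(1,2) r by (auto simp: field_simps)
  then have "x \<in> side (Tri c r) i"
    using x(1) r assms(2) by (auto simp: mem_side_iff mem_tri_points_iff jk(1))
  then have "x \<in> grid"
    using assms(3) by blast
  then have "\<exists>l\<in>{i,j,k}. coord l x \<in> \<int>"
    by (simp only: jk(1) mem_grid_iff)
  then have "coord j x \<in> \<int> \<or> coord k x \<in> \<int>"
    using K x(1) by auto
  then have "- (r * coord j x) \<in> \<int> \<or> r * coord k x \<in> \<int>"
    by auto
  moreover have e: "- (r * coord j x) = (- r * coord j c - 1 / 3) + s" "r * coord k x
    = r * coord k c - 2 / 3 + s"
    using x r by (auto simp: algebra_simps)
  ultimately show False
    unfolding e using s(3,4) by blast
qed

lemma mem_grid_triangles_iff: "t \<in> grid_triangles \<longleftrightarrow> \<bar>tri_ratio t\<bar> = 1 \<and> aligned t"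
proof -
  obtain c r where t: "t = Tri c r" by (cases t)
  have "side (Tri c r) i \<subseteq> grid \<longleftrightarrow> coord i c + r / 3 \<in> \<int>" if "\<bar>r\<bar> = 1" "i \<in> {1,2,3}" for i
  proof
    assume "coord i c + r / 3 \<in> \<int>"
    then show "side (Tri c r) i \<subseteq> grid"
      using that mem_side_iff[of r i _ c] by (fastforce simp: mem_grid_iff)
  qed (rule aligned_side_coord[OF that])
  then show ?thesis
    by (auto simp: grid_triangles_def unit_triangles_of_def sides_def aligned_def t)
qed

lemma grid_trianglesE:
  assumes "t \<in> grid_triangles"
  obtains c r N where "t = Tri c r" "r = 1 \<or> r = - 1" "aligned t"
    "\<And>i. i \<in> {1,2,3} \<Longrightarrow> coord i c = of_int (N i) - r / 3" "N 1 + N 2 + N 3 = r - 1"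
proof -
  obtain c r where t: "t = Tri c r" by (cases t)
  then have a: "aligned (Tri c r)" and r: "r = 1 \<or> r = - 1"
    using assms by (auto simp: mem_grid_triangles_iff)
  from a show ?thesis
    by (rule alignedE) (use that t r a in auto)
qed

text \<open>Converse of the labelling by grid lines: the labels of a unit triangle sum to
  \<open>0\<close> if it is positive and to \<open>- 2\<close> if it is negative.\<close>

lemma grid_triangle_exists:
  assumes "N 1 + N 2 + N 3 = r - 1" "r = 1 \<or> r = - 1"
  obtains c where "Tri c r \<in> grid_triangles" "\<And>i. i \<in> {1,2,3} \<Longrightarrow> coord i c = of_int (N i) - r / 3"
proof -
  have "real_of_int (N 1 + N 2 + N 3) = of_int (r - 1)"
    by (simp only: assms(1))
  then have "(of_int (N 1) - r / 3) + (of_int (N 2) - r / 3) + (of_int (N 3) - r / 3) = - 1"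
    by simp
  then obtain c where "coord 1 c = of_int (N 1) - r / 3" "coord 2 c = of_int (N 2) - r / 3"
    "coord 3 c = of_int (N 3) - r / 3"
    by (rule coord_exists)
  then have c: "coord i c = of_int (N i) - r / 3" if "i \<in> {1,2,3}" for i
    using that by auto
  have "Tri c r \<in> grid_triangles"
    unfolding mem_grid_triangles_iff using alignedI[OF c] assms(2) by auto
  then show ?thesis using that c by blast
qed

lemma unit_triangles_aligned:
  assumes "aligned t"
  shows "unit_triangles t = {u \<in> grid_triangles. tri_points u \<subseteq> tri_points t}"
  using assms by (simp add: unit_triangles_def grid_triangles_def subdivision_grid_aligned)

section \<open>Points off the grid and the orientation of the unit triangle around them\<close>

definition off_grid_ratio :: "complex \<Rightarrow> int" where
  "off_grid_ratio x = (if \<lfloor>coord 1 x\<rfloor> + \<lfloor>coord 2 x\<rfloor> + \<lfloor>coord 3 x\<rfloor> = - 3 then 1 else - 1)"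

text \<open>The three fractional parts are strictly between \<open>0\<close> and \<open>1\<close>
  and have an integral sum, which is \<open>2\<close> or \<open>1\<close>. Sum \<open>2\<close>,
  that is floors adding up to \<open>- 3\<close>, occurs in positive triangles: there the upper
  bounds are the grid labels, with sum \<open>0\<close>.\<close>

lemma floor_coord_sum:
  assumes "x \<notin> grid"
  shows "\<lfloor>coord 1 x\<rfloor> + \<lfloor>coord 2 x\<rfloor> + \<lfloor>coord 3 x\<rfloor> \<in> {- 3, - 2}"
proof -
  have *: "of_int \<lfloor>coord i x\<rfloor> < coord i x" "coord i x < of_int \<lfloor>coord i x\<rfloor> + 1" if "i \<in> {1,2,3}"
    for i
  proof -
    have "coord i x \<noteq> of_int \<lfloor>coord i x\<rfloor>"
      using assms that by (metis Ints_of_int mem_grid_iff)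
    then show "of_int \<lfloor>coord i x\<rfloor> < coord i x"
      using of_int_floor_le[of "coord i x"] by linarith
  qed linarith
  show ?thesis
    using *[of 1] *[of 2] *[of 3] coord_sum[of x] by (simp; linarith)
qed

lemma off_grid_cell:
  assumes "t \<in> grid_triangles" "x \<in> tri_points t" "x \<notin> grid"
  shows "tri_points t = cell x" "tri_ratio t = off_grid_ratio x"
proof -
  from assms(1) obtain c r N where t: "t = Tri c r" "r = 1 \<or> r = - 1" "aligned t"
    and N: "\<And>i. i \<in> {1,2,3} \<Longrightarrow> coord i c = of_int (N i) - r / 3" "N 1 + N 2 + N 3 = r - 1"
    by (rule grid_trianglesE) blast
  have Ns: "real_of_int (N 1) + N 2 + N 3 = r - 1"
    using N(2) by (metis of_int_add of_int_diff of_int_1)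
  have nz: "coord i x \<noteq> of_int n" if "i \<in> {1,2,3}" for i n
    using assms(3) that by (auto simp: mem_grid_iff)
  have sub: "cell x \<subseteq> tri_points t"
    by (rule cell_subset_tri_points) (use t assms in auto)
  from t(2) have "tri_points t \<subseteq> cell x \<and> tri_ratio t = off_grid_ratio x"
  proof
    assume r: "r = 1"
    have le: "\<forall>i\<in>{1,2,3}. coord i y \<le> N i" if "y \<in> tri_points t" for y
      using that N(1) unfolding t(1) r by (auto simp: mem_tri_points_pos)
    \<comment> \<open>The labels sum to \<open>0\<close> and the coordinates to \<open>- 1\<close>,
      so upper bounds on two coordinates give a lower bound on the third.\<close>
    have ge: "\<forall>i\<in>{1,2,3}. N i - 1 \<le> coord i y" if "y \<in> tri_points t" for y
      using le[OF that] coord_sum[of y] Ns r by auto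
    have fl: "\<lfloor>coord i x\<rfloor> = N i - 1" "\<lceil>coord i x\<rceil> = N i" if "i \<in> {1,2,3}" for i
    proof -
      have "N i - 1 \<le> coord i x" "coord i x < N i"
        using le[OF assms(2)] ge[OF assms(2)] nz[OF that, of "N i"] that
          by (auto simp: order_less_le)
      moreover have "N i - 1 \<noteq> coord i x"
        using nz[OF that, of "N i - 1"] by auto
      ultimately show "\<lfloor>coord i x\<rfloor> = N i - 1" "\<lceil>coord i x\<rceil> = N i"
        by (auto intro!: floor_unique ceiling_unique)
    qed
    have "tri_points t \<subseteq> cell x"
      using le ge unfolding cell_def by (auto simp: fl)
    then show ?thesis
      using N(2) r t(1) by (simp add: off_grid_ratio_def fl)
  next
    assume r: "r = - 1"
    have ge: "\<forall>i\<in>{1,2,3}. N i \<le> coord i y" if "y \<in> tri_points t" for y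
      using that N(1) unfolding t(1) r by (auto simp: mem_tri_points_neg)
    have le: "\<forall>i\<in>{1,2,3}. coord i y \<le> N i + 1" if "y \<in> tri_points t" for y
      using ge[OF that] coord_sum[of y] Ns r by auto
    have fl: "\<lfloor>coord i x\<rfloor> = N i" "\<lceil>coord i x\<rceil> = N i + 1" if "i \<in> {1,2,3}" for i
    proof -
      have "N i < coord i x" "coord i x \<le> N i + 1"
        using le[OF assms(2)] ge[OF assms(2)] nz[OF that, of "N i"] that
          by (auto simp: order_less_le)
      moreover have "N i + 1 \<noteq> coord i x"
        using nz[OF that, of "N i + 1"] by auto
      ultimately show "\<lfloor>coord i x\<rfloor> = N i" "\<lceil>coord i x\<rceil> = N i + 1"
        by (auto intro!: floor_unique ceiling_unique)
    qed
    have "tri_points t \<subseteq> cell x"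
      using le ge unfolding cell_def by (auto simp: fl)
    then show ?thesis
      using N(2) r t(1) by (simp add: off_grid_ratio_def fl)
  qed
  then show "tri_points t = cell x" "tri_ratio t = off_grid_ratio x"
    using sub by auto
qed

lemma off_grid_triangle:
  assumes "x \<notin> grid"
  obtains t where "t \<in> grid_triangles" "x \<in> tri_points t"
proof -
  consider "\<lfloor>coord 1 x\<rfloor> + \<lfloor>coord 2 x\<rfloor> + \<lfloor>coord 3 x\<rfloor> = - 3" | "\<lfloor>coord 1 x\<rfloor> + \<lfloor>coord 2 x\<rfloor>
    + \<lfloor>coord 3 x\<rfloor> = - 2"
    using floor_coord_sum[OF assms] by auto
  then show ?thesis
  proof cases
    case 1
    then have "(\<lfloor>coord 1 x\<rfloor> + 1) + (\<lfloor>coord 2 x\<rfloor> + 1) + (\<lfloor>coord 3 x\<rfloor> + 1) = 1 - 1"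
      by simp
    then obtain c where c: "Tri c 1 \<in> grid_triangles"
      "\<And>i. i \<in> {1,2,3} \<Longrightarrow> coord i c = of_int (\<lfloor>coord i x\<rfloor> + 1) - of_int 1 / 3"
      by (rule grid_triangle_exists) auto
    have "coord i x \<le> coord i c + of_int 1 / 3" if "i \<in> {1,2,3}" for i
      unfolding c(2)[OF that] by simp linarith
    then have "x \<in> tri_points (Tri c 1)"
      unfolding mem_tri_points_pos[OF zero_less_one] by (intro ballI)
    then show ?thesis
      by (rule that[OF c(1)])
  next
    case 2
    then obtain c where "Tri c (- 1) \<in> grid_triangles"
      "\<And>i. i \<in> {1,2,3} \<Longrightarrow> coord i c = of_int \<lfloor>coord i x\<rfloor> - of_int (- 1) / 3"
      using grid_triangle_exists[of "\<lambda>i. \<lfloor>coord i x\<rfloor>" "- 1"] by auto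
    then show ?thesis
      using that[of "Tri c (- 1)"] by (auto simp: mem_tri_points_neg)
  qed
qed

text \<open>The coordinates of the center are \<open>N i - r / 3\<close> with \<open>r\<close> not
  divisible by \<open>3\<close>.\<close>

lemma center_notin_grid:
  assumes "t \<in> grid_triangles"
  shows "tri_center t \<notin> grid" "tri_center t \<in> tri_points t"
proof -
  from assms obtain c r N where t: "t = Tri c r" "r = 1 \<or> r = - 1" "aligned t"
    and N: "\<And>i. i \<in> {1,2,3} \<Longrightarrow> coord i c = of_int (N i) - r / 3" "N 1 + N 2 + N 3 = r - 1"
    by (rule grid_trianglesE) blast
  have "of_int n - r / 3 \<notin> \<int>" for n
  proof
    assume "real_of_int n - r / 3 \<in> \<int>"
    then obtain k where "real_of_int n - r / 3 = of_int k" by (rule Ints_cases)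
    then have "real_of_int (3 * n - r) = of_int (3 * k)" by simp
    then have "3 * n - r = 3 * k" by linarith
    then show False using t(2) by presburger
  qed
  then show "tri_center t \<notin> grid"
    using N(1) by (auto simp: t(1) mem_grid_iff)
  show "tri_center t \<in> tri_points t"
    using t by (auto simp: mem_tri_points_iff)
qed

lemma coord_vertex:
  assumes "i \<in> {1,2,3}" "j \<in> {1,2,3}" "i \<noteq> j"
  shows "coord i (vertex (Tri c r) j) = coord i c + r / 3"
  using assms by (auto simp: vertex_def coord_def xi_simps inner_complex_def field_simps)

lemma vertex_in_side:
  assumes "i \<in> {1,2,3}" "j \<in> {1,2,3}" "i \<noteq> j"
  shows "vertex t j \<in> side t i"
proof -
  have "vertex t 4 = vertex t 1" "vertex t 5 = vertex t 2"
    by (simp_all add: vertex_def xi_4 xi_5)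
  then show ?thesis using assms by (auto simp: side_def)
qed

text \<open>The center of \<open>u\<close> is off the grid, so both triangles have its cell as point
  set and its orientation. The centers then agree because coordinate \<open>i\<close> attains its
  extreme value over the triangle at any vertex \<open>j\<close> other than
  \<open>i\<close>.\<close>

lemma grid_triangle_eq:
  assumes "t \<in> grid_triangles" "u \<in> grid_triangles" "tri_center u \<in> tri_points t"
  shows "t = u"
proof -
  have eq: "tri_points t = cell (tri_center u)" "tri_ratio t = off_grid_ratio (tri_center u)"
    "tri_points u = cell (tri_center u)" "tri_ratio u = off_grid_ratio (tri_center u)"
    using off_grid_cell center_notin_grid[OF assms(2)] assms by blast+
  obtain c r where t: "t = Tri c r" and r: "r = 1 \<or> r = - 1"
    using assms(1) by (auto elim: grid_trianglesE)
  obtain c' where u: "u = Tri c' r"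
    using eq t by (cases u) auto
  have r0: "r \<noteq> 0" using r by auto
  have "coord i c = coord i c'" if "i \<in> {1,2,3}" for i
  proof -
    obtain j where j: "j \<in> {1,2,3}" "i \<noteq> j"
      using another_index[of i i] by blast
    have "vertex v j \<in> tri_points v" for v
      using j(1) by (auto simp: tri_points_def hull_inc)
    then have "vertex t j \<in> tri_points u" "vertex u j \<in> tri_points t"
      using eq(1,3) by metis+
    then have "(coord i (vertex (Tri c r) j) - coord i c') / r \<le> 1 / 3"
      "(coord i (vertex (Tri c' r) j) - coord i c) / r \<le> 1 / 3"
      using that unfolding t u mem_tri_points_iff[OF r0] by blast+
    then show ?thesis
      unfolding coord_vertex[OF that j(1,2)] using r by (elim disjE) simp_all
  qed
  then show ?thesis
    using coord_eqI t u by blast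
qed

section \<open>Relative interiors of grid edges, where exactly one coordinate is integral\<close>

definition edge_pt :: "nat \<Rightarrow> complex \<Rightarrow> bool" where
  "edge_pt i x \<longleftrightarrow> i \<in> {1,2,3} \<and> (\<forall>j\<in>{1,2,3}. coord j x \<in> \<int> \<longleftrightarrow> j = i)"

lemma edge_ptD:
  assumes "edge_pt i x"
  shows "i \<in> {1,2,3}" "coord i x \<in> \<int>" "\<And>j. j \<in> {1,2,3} \<Longrightarrow> j \<noteq> i \<Longrightarrow> coord j x \<notin> \<int>"
  using assms unfolding edge_pt_def by blast+

lemma grid_edge_generic_point:
  assumes "e \<in> grid_edges"
  obtains i x where "edge_pt i x" "x \<in> e"
proof -
  from assms obtain t i where t: "t \<in> grid_triangles" and i: "i \<in> {1,2,3}" and e: "e = side t i"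
    unfolding grid_edges_def sides_def by blast
  from t obtain c r N where t: "t = Tri c r" "r = 1 \<or> r = - 1"
    and N: "\<And>i. i \<in> {1,2,3} \<Longrightarrow> coord i c = of_int (N i) - r / 3"
    by (rule grid_trianglesE) blast
  obtain j k where jk: "{i, j, k} = {1,2,3::nat}" "i \<noteq> j" "i \<noteq> k" "j \<noteq> k"
    using i by (rule other_indicesE)
  then have jk_in: "j \<in> {1,2,3}" "k \<in> {1,2,3}" by blast+
  \<comment> \<open>The chosen point is the midpoint of the edge: its other two coordinates are
    half-integers.\<close>
  have "of_int (N i) + (of_int (N j) - r / 2) + (of_int (N k) - r / 2) = - 1"
    using coord_sum_perm[OF jk, of c] N[OF i] N[OF jk_in(1)] N[OF jk_in(2)] by simp
  then obtain x where x: "coord i x = of_int (N i)" "coord j x = of_int (N j) - r / 2"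
    "coord k x = of_int (N k) - r / 2"
    by (rule coord_exists_perm[OF jk])
  have "of_int n - r / 2 \<notin> \<int>" for n
  proof
    assume "real_of_int n - r / 2 \<in> \<int>"
    then obtain k where "real_of_int n - r / 2 = of_int k" by (rule Ints_cases)
    then have "real_of_int (2 * n - r) = of_int (2 * k)" by simp
    then have "2 * n - r = 2 * k" by linarith
    then show False using t(2) by presburger
  qed
  then have "\<forall>l\<in>{i,j,k}. coord l x \<in> \<int> \<longleftrightarrow> l = i"
    using x jk(2-) by auto
  then have "edge_pt i x"
    unfolding edge_pt_def jk(1) using i by blast
  have "\<forall>l\<in>{i,j,k}. (coord l x - coord l c) / r \<le> 1 / 3"
    using x N[OF i] N[OF jk_in(1)] N[OF jk_in(2)] t(2) by auto
  moreover have "r \<noteq> 0" using t(2) by auto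
  ultimately have "x \<in> e"
    unfolding e t(1) using x(1) N[OF i] i by (simp add: mem_side_iff mem_tri_points_iff jk(1))
  then show ?thesis using that \<open>edge_pt i x\<close> by blast
qed

lemma not_Ints_strict:
  fixes x :: real
  assumes "x \<notin> \<int>"
  shows "of_int \<lfloor>x\<rfloor> < x" "x < of_int \<lfloor>x\<rfloor> + 1" "\<lceil>x\<rceil> = \<lfloor>x\<rfloor> + 1"
proof -
  have "x \<noteq> of_int \<lfloor>x\<rfloor>"
    using assms by (metis Ints_of_int)
  then show "of_int \<lfloor>x\<rfloor> < x"
    using of_int_floor_le[of x] by linarith
  then show "\<lceil>x\<rceil> = \<lfloor>x\<rfloor> + 1"
    by (intro ceiling_unique) (auto intro: less_imp_le[OF floor_correct[THEN conjunct2]])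
qed linarith

text \<open>With one coordinate fixed, the bounds on the other two confine each of them to a unit
  interval. An interior point of the edge has both strictly inside, so its floors and ceilings
  recover the ends of these intervals.\<close>

lemma side_eq_cell:
  assumes "t \<in> grid_triangles" "l \<in> {1,2,3}" "x \<in> side t l" "edge_pt i x"
  shows "l = i" "side t l = cell x"
proof -
  from assms(1) obtain c r N where t: "t = Tri c r" "r = 1 \<or> r = - 1" "aligned t"
    and N: "\<And>i. i \<in> {1,2,3} \<Longrightarrow> coord i c = of_int (N i) - r / 3" "N 1 + N 2 + N 3 = r - 1"
    by (rule grid_trianglesE) blast
  have r0: "r \<noteq> 0" using t(2) by auto
  \<comment> \<open>The factor \<open>r\<close> treats both orientations at once: the labels are
    upper bounds for \<open>r = 1\<close> and lower bounds for \<open>r = - 1\<close>.\<close>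
  have mem: "y \<in> side t l \<longleftrightarrow> coord l y = N l \<and> (\<forall>j\<in>{1,2,3}. r * coord j y \<le> r * N j)" for y
  proof -
    have "(coord j y - coord j c) / r \<le> 1 / 3 \<longleftrightarrow> r * coord j y \<le> r * N j" if "j \<in> {1,2,3}" for j
      using t(2) N(1)[OF that] by (elim disjE) simp_all
    then show ?thesis
      using N(1)[OF assms(2)] unfolding t(1) mem_side_iff[OF r0 assms(2)] mem_tri_points_iff[OF r0]
      by auto
  qed
  then have "coord l x = N l" using assms(3) by blast
  then show "l = i" using assms(2,4) by (auto simp: edge_pt_def)
  show "side t l = cell x"
  proof
    show "cell x \<subseteq> side t l"
      by (rule cell_subset_side) (use t assms r0 in auto)
    obtain j k where jk: "{l, j, k} = {1,2,3::nat}" "l \<noteq> j" "l \<noteq> k" "j \<noteq> k"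
      using assms(2) by (rule other_indicesE)
    then have jk_in: "j \<in> {1,2,3}" "k \<in> {1,2,3}" by blast+
    have Ns: "N l + N j + N k = r - 1"
      using coord_sum_perm[OF jk, of c] N(1)[OF assms(2)] N(1)[OF jk_in(1)] N(1)[OF jk_in(2)]
        by linarith
    have ni: "coord j x \<notin> \<int>" "coord k x \<notin> \<int>"
      using edge_ptD[OF assms(4)] \<open>l = i\<close> jk(2-) jk_in by auto
    have x: "r * coord j x \<le> r * N j" "r * coord k x \<le> r * N k"
      using mem assms(3) jk_in by blast+
    have sx: "coord l x + coord j x + coord k x = - 1"
      by (rule coord_sum_perm[OF jk])
    show "side t l \<subseteq> cell x"
    proof
      fix y assume "y \<in> side t l"
      then have y: "coord l y = N l" "r * coord j y \<le> r * N j" "r * coord k y \<le> r * N k"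
        using mem jk_in by blast+
      have sy: "coord l y + coord j y + coord k y = - 1"
        by (rule coord_sum_perm[OF jk])
      have "\<lfloor>coord j x\<rfloor> \<le> coord j y \<and> coord j y \<le> \<lceil>coord j x\<rceil> \<and> \<lfloor>coord k x\<rfloor> \<le> coord k y
        \<and> coord k y \<le> \<lceil>coord k x\<rceil>"
        using t(2)
      proof
        assume r: "r = 1"
        have "coord j x \<noteq> of_int (N j)" "coord k x \<noteq> of_int (N k)" using ni by auto
        then have "coord j x < of_int (N j)" "coord k x < of_int (N k)" using x r by auto
        then have "\<lfloor>coord j x\<rfloor> = N j - 1" "\<lfloor>coord k x\<rfloor> = N k - 1"
          using sx \<open>coord l x = N l\<close> Ns r by linarith+
        then show ?thesis
          unfolding not_Ints_strict(3)[OF ni(1)] not_Ints_strict(3)[OF ni(2)]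
          using y sy Ns r by auto
      next
        assume r: "r = - 1"
        have "coord j x \<noteq> of_int (N j)" "coord k x \<noteq> of_int (N k)" using ni by auto
        then have "coord j x > of_int (N j)" "coord k x > of_int (N k)" using x r by auto
        then have "\<lfloor>coord j x\<rfloor> = N j" "\<lfloor>coord k x\<rfloor> = N k"
          using sx \<open>coord l x = N l\<close> Ns r by linarith+
        then show ?thesis
          unfolding not_Ints_strict(3)[OF ni(1)] not_Ints_strict(3)[OF ni(2)]
          using y sy Ns r by auto
      qed
      then have "\<forall>m\<in>{l,j,k}. \<lfloor>coord m x\<rfloor> \<le> coord m y \<and> coord m y \<le> \<lceil>coord m x\<rceil>"
        using y(1) \<open>coord l x = N l\<close> by simp
      then show "y \<in> cell x"
        unfolding cell_def jk(1) by blast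
    qed
  qed
qed

lemma grid_edge_eq_cell:
  assumes "e \<in> grid_edges" "x \<in> e" "edge_pt i x"
  shows "e = cell x"
  using assms side_eq_cell(2) unfolding grid_edges_def sides_def by blast

lemma edge_pt_side:
  assumes "edge_pt i x" "r = 1 \<or> r = - 1"
  obtains c where "Tri c r \<in> grid_triangles" "cell x = side (Tri c r) i"
proof -
  have i: "i \<in> {1,2,3}" using assms(1) by (simp add: edge_pt_def)
  obtain j k where jk: "{i, j, k} = {1,2,3::nat}" "i \<noteq> j" "i \<noteq> k" "j \<noteq> k"
    using i by (rule other_indicesE)
  then have jk_in: "j \<in> {1,2,3}" "k \<in> {1,2,3}" by blast+
  have ni: "coord j x \<notin> \<int>" "coord k x \<notin> \<int>" "coord i x \<in> \<int>"
    using edge_ptD[OF assms(1)] jk(2-) jk_in by auto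
  obtain n where n: "coord i x = of_int n"
    using ni(3) by (rule Ints_cases)
  have sx: "coord i x + coord j x + coord k x = - 1"
    by (rule coord_sum_perm[OF jk])
  \<comment> \<open>Every edge borders one triangle of each orientation. The positive one has the
    ceilings as its upper bounds, the negative one the floors as its lower bounds.\<close>
  define N where "N l = (if r = 1 then \<lceil>coord l x\<rceil> else \<lfloor>coord l x\<rfloor>)" for l
  have "N 1 + N 2 + N 3 = sum N {i,j,k}"
    unfolding jk(1) by simp
  also have "\<dots> = N i + N j + N k"
    using jk(2-) by simp
  also have "\<dots> = r - 1"
  proof -
    have "N i = n" using n by (simp add: N_def)
    moreover have "real_of_int n + coord j x + coord k x = - 1" using sx n by simp
    ultimately show ?thesis
      using assms(2) not_Ints_strict[OF ni(1)] not_Ints_strict[OF ni(2)]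
      by (auto simp: N_def) linarith+
  qed
  finally obtain c where t: "Tri c r \<in> grid_triangles"
    and c: "\<And>i. i \<in> {1,2,3} \<Longrightarrow> coord i c = of_int (N i) - r / 3"
    using grid_triangle_exists assms(2) by blast
  have "coord i x = N i" using n by (simp add: N_def)
  moreover have "(coord l x - coord l c) / r \<le> 1 / 3" if "l \<in> {1,2,3}" for l
    using c[OF that] assms(2) by (auto simp: N_def)
  ultimately have "x \<in> side (Tri c r) i"
    using i assms(2) c[OF i] by (auto simp: mem_side_iff mem_tri_points_iff)
  then have "side (Tri c r) i = cell x"
    by (rule side_eq_cell(2)[OF t i _ assms(1)])
  then show ?thesis using that t by metis
qed

lemma cell_grid_edge:
  assumes "edge_pt i x"
  shows "cell x \<in> grid_edges"
proof -
  obtain c where "Tri c 1 \<in> grid_triangles" "cell x = side (Tri c 1) i"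
    using edge_pt_side[OF assms] by blast
  then show ?thesis
    using assms unfolding grid_edges_def sides_def edge_pt_def by blast
qed

lemma sides_subset_tri_points:
  assumes "e \<in> sides t"
  shows "e \<subseteq> tri_points t"
proof -
  have "vertex t 4 = vertex t 1" "vertex t 5 = vertex t 2"
    by (simp_all add: vertex_def xi_4 xi_5)
  then obtain i j where "e = convex hull {vertex t i, vertex t j}" "{vertex t i, vertex t j}
    \<subseteq> {vertex t 1, vertex t 2, vertex t 3}"
    using assms by (auto simp: sides_def side_def segment_convex_hull)
  then show ?thesis
    unfolding tri_points_def by (simp only: hull_mono)
qed

text \<open>For the nontrivial inclusion, of the two unit triangles at an edge the one oriented like
  \<open>t\<close> is taken: it is inside \<open>t\<close> even if the edge lies on the
  boundary.\<close>

lemma unit_edges_aligned: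
  assumes "aligned t" "tri_ratio t \<noteq> 0"
  shows "unit_edges t = {e \<in> grid_edges. e \<subseteq> tri_points t}"
proof
  show "unit_edges t \<subseteq> {e \<in> grid_edges. e \<subseteq> tri_points t}"
    using sides_subset_tri_points unfolding unit_edges_def unit_triangles_aligned[OF assms(1)]
      grid_edges_def
    by blast
  show "{e \<in> grid_edges. e \<subseteq> tri_points t} \<subseteq> unit_edges t"
  proof clarify
    fix e assume e: "e \<in> grid_edges" "e \<subseteq> tri_points t"
    then obtain i x where x: "edge_pt i x" "x \<in> e"
      using grid_edge_generic_point by blast
    then have i: "i \<in> {1,2,3}" by (simp add: edge_pt_def)
    have "e = cell x"
      by (rule grid_edge_eq_cell[OF e(1) x(2,1)])
    define r where "r = sgn (tri_ratio t)"
    have r: "r = 1 \<or> r = - 1"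
      using assms(2) by (simp add: r_def sgn_if)
    then obtain d where u: "Tri d r \<in> grid_triangles" "cell x = side (Tri d r) i"
      using edge_pt_side[OF x(1)] by blast
    obtain c m where t: "t = Tri c m" by (cases t)
    have "(coord l y - coord l c) / m \<le> 1 / 3" if y: "y \<in> tri_points (Tri d r)" and l: "l \<in> {1,2,3}"
      for y l
    proof -
      \<comment> \<open>Vertex \<open>j\<close> lies on the edge, hence in \<open>t\<close>, and
        coordinate \<open>l\<close> of the unit triangle is extreme there; so the bound at this
        vertex holds on the whole triangle.\<close>
      obtain j where j: "j \<in> {1,2,3}" "l \<noteq> j" "i \<noteq> j"
        using another_index[of l i] by blast
      then have "vertex (Tri d r) j \<in> tri_points t"
        using e(2) vertex_in_side[OF i j(1,3)] \<open>e = cell x\<close> u(2) by blast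
      then show ?thesis
        using y l assms(2) coord_vertex[OF l j(1,2), of d r] r unfolding t r_def
        by (auto simp: sgn_if mem_tri_points_pos mem_tri_points_neg field_simps split: if_splits)
    qed
    then have "tri_points (Tri d r) \<subseteq> tri_points t"
      using assms(2) unfolding t by (simp add: mem_tri_points_iff subset_iff)
    then have "Tri d r \<in> unit_triangles t"
      using u(1) by (simp add: unit_triangles_aligned[OF assms(1)])
    then show "e \<in> unit_edges t"
      unfolding unit_edges_def sides_def using u(2) i \<open>e = cell x\<close> by blast
  qed
qed

subsection \<open>Inflation\<close>

text \<open>The shift \<open>(r - 1) / 3\<close> of \<open>coord_scale\<close> is integral exactly
  for ratios \<open>r = 3 q + 1\<close>. The case \<open>q = - 1\<close> is the inflation
  \<open>- 2\<close> of the foldings, \<open>q = 1\<close> the inflation \<open>4\<close> of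
  \<open>F_P\<close>.\<close>

lemma coord_aff_0: "coord i (aff (3 * q + 1) 0 x) = of_int (3 * q + 1) * coord i x + of_int q"
  by (simp add: aff_0 coord_scale)

lemma aff_0_in_grid:
  assumes "x \<in> grid"
  shows "aff (3 * q + 1) 0 x \<in> grid"
proof -
  obtain i where i: "i \<in> {1,2,3}" "coord i x \<in> \<int>"
    using assms unfolding mem_grid_iff by blast
  then have "coord i (aff (3 * q + 1) 0 x) \<in> \<int>"
    unfolding coord_aff_0 by simp
  then show ?thesis
    using i(1) unfolding mem_grid_iff by blast
qed

lemma aligned_aff_tri_0:
  assumes "aligned t"
  shows "aligned (aff_tri (3 * q + 1) 0 t)"
  unfolding aligned_def
proof
  fix i :: nat assume "i \<in> {1,2,3}"
  then have *: "coord i (tri_center t) + tri_ratio t / 3 \<in> \<int>"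
    using assms unfolding aligned_def by blast
  have "coord i (tri_center (aff_tri (3 * q + 1) 0 t)) + tri_ratio (aff_tri (3 * q + 1) 0 t) / 3
    = of_int (3 * q + 1) * (coord i (tri_center t) + tri_ratio t / 3) + of_int q"
    unfolding aff_tri_simps coord_aff_0 by (simp add: algebra_simps)
  then show "coord i (tri_center (aff_tri (3 * q + 1) 0 t)) + tri_ratio (aff_tri (3 * q
    + 1) 0 t) / 3 \<in> \<int>"
    using * by (simp only: Ints_add Ints_mult Ints_of_int)
qed

text \<open>Integer bounds on the coordinates of \<open>x\<close> become integer bounds on those of
  its image, with floor and ceiling changing places if the ratio is negative.\<close>

lemma cell_aff_0: "cell (aff (3 * q + 1) 0 x) \<subseteq> aff (3 * q + 1) 0 ` cell x"
proof
  define r where "r = 3 * q + 1"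
  have r0: "r \<noteq> 0" unfolding r_def by presburger
  fix y assume y: "y \<in> cell (aff (3 * q + 1) 0 x)"
  define z where "z = (1 / of_int r) *\<^sub>R y"
  have yz: "y = aff r 0 z"
    using r0 by (simp add: z_def aff_0)
  have "of_int \<lfloor>coord i x\<rfloor> \<le> coord i z \<and> coord i z \<le> of_int \<lceil>coord i x\<rceil>" if "i \<in> {1,2,3}" for i
  proof -
    have *: "of_int \<lfloor>r * coord i x + q\<rfloor> \<le> r * coord i z + q" "r * coord i z
      + q \<le> of_int \<lceil>r * coord i x + q\<rceil>"
      using y that unfolding cell_def yz r_def mem_Collect_eq coord_aff_0 by blast+
    show ?thesis
    proof (cases "r > 0")
      case True
      have "of_int (r * \<lfloor>coord i x\<rfloor> + q) \<le> r * coord i x + q" "r * coord i x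
        + q \<le> of_int (r * \<lceil>coord i x\<rceil> + q)"
        using True by simp_all
      then have "r * \<lfloor>coord i x\<rfloor> + q \<le> \<lfloor>r * coord i x + q\<rfloor>" "\<lceil>r * coord i x + q\<rceil> \<le> r * \<lceil>coord i x\<rceil>
        + q"
        by (simp_all only: le_floor_iff ceiling_le_iff)
      then have "of_int (r * \<lfloor>coord i x\<rfloor> + q) \<le> r * coord i z + q" "r * coord i z
        + q \<le> of_int (r * \<lceil>coord i x\<rceil> + q)"
        using * by linarith+
      then show ?thesis using True by simp
    next
      case False
      then have neg: "r < 0" using r0 by simp
      have "of_int (r * \<lceil>coord i x\<rceil> + q) \<le> r * coord i x + q" "r * coord i x
        + q \<le> of_int (r * \<lfloor>coord i x\<rfloor> + q)"
        using neg by simp_all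
      then have "r * \<lceil>coord i x\<rceil> + q \<le> \<lfloor>r * coord i x + q\<rfloor>" "\<lceil>r * coord i x + q\<rceil> \<le> r * \<lfloor>coord i x\<rfloor>
        + q"
        by (simp_all only: le_floor_iff ceiling_le_iff)
      then have "of_int (r * \<lceil>coord i x\<rceil> + q) \<le> r * coord i z + q" "r * coord i z
        + q \<le> of_int (r * \<lfloor>coord i x\<rfloor> + q)"
        using * by linarith+
      then show ?thesis using neg by simp
    qed
  qed
  then have "z \<in> cell x"
    unfolding cell_def by blast
  then show "y \<in> aff (3 * q + 1) 0 ` cell x"
    using yz unfolding r_def by blast
qed

lemma coord_double: "coord i (aff (- 2) 0 x) = - 2 * coord i x - 1"
  using coord_aff_0[of i "- 1" x] by simp

lemma aligned_double: "aligned t \<Longrightarrow> aligned (aff_tri (- 2) 0 t)"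
  using aligned_aff_tri_0[of t "- 1"] by simp

lemma cell_double: "cell (aff (- 2) 0 x) \<subseteq> aff (- 2) 0 ` cell x"
  using cell_aff_0[of "- 1" x] by simp

lemma double_surj: obtains y where "x = aff (- 2) 0 y"
proof
  show "x = aff (- 2) 0 ((- 1 / 2) *\<^sub>R x)"
    by (simp add: aff_0)
qed

text \<open>The inflation keeps integral coordinates integral, so \<open>i\<close> is the only index
  at which \<open>x\<close> can have one, and on the grid it must have one.\<close>

lemma edge_pt_half:
  assumes "edge_pt i (aff (- 2) 0 x)" "x \<in> grid"
  shows "edge_pt i x"
proof -
  have *: "coord j (aff (- 2) 0 x) \<in> \<int>" if "coord j x \<in> \<int>" for j
    unfolding coord_double using that by simp
  obtain j where j: "j \<in> {1,2,3}" "coord j x \<in> \<int>"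
    using assms(2) unfolding mem_grid_iff by blast
  then have "j = i"
    using *[OF j(2)] edge_ptD(3)[OF assms(1) j(1)] by blast
  moreover have "coord k x \<notin> \<int>" if "k \<in> {1,2,3}" "k \<noteq> i" for k
    using *[of k] edge_ptD(3)[OF assms(1) that] by blast
  ultimately show ?thesis
    unfolding edge_pt_def using j by blast
qed

lemma grid_edge_subset_grid:
  assumes "e \<in> grid_edges"
  shows "e \<subseteq> grid"
  using assms unfolding grid_edges_def grid_triangles_def unit_triangles_of_def by blast

text \<open>An interior point of a half edge pulls back to an interior point of the original edge.
  This determines \<open>E\<close> from \<open>E'\<close>, which makes the definite description in
  \<open>F_plus\<close> meaningful.\<close>

lemma half_edge_cells:
  assumes "E \<in> grid_edges" "E' \<in> grid_edges" "E' \<subseteq> aff (- 2) 0 ` E" "edge_pt i (aff (- 2) 0 x)"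
    "aff (- 2) 0 x \<in> E'"
  shows "edge_pt i x" "E = cell x" "E' = cell (aff (- 2) 0 x)"
proof -
  have x: "x \<in> E"
    using assms(3,5) inj_aff[of "- 2" 0] by (auto dest: injD)
  then have "x \<in> grid"
    using grid_edge_subset_grid[OF assms(1)] by blast
  then show "edge_pt i x"
    by (rule edge_pt_half[OF assms(4)])
  then show "E = cell x"
    by (rule grid_edge_eq_cell[OF assms(1) x])
  show "E' = cell (aff (- 2) 0 x)"
    by (rule grid_edge_eq_cell[OF assms(2,5,4)])
qed

text \<open>The normalized deviations from the center sum to \<open>0\<close>; being at most
  \<open>1 / 3\<close> each, they are at least \<open>- 2 / 3\<close>.\<close>

lemma central_triangle_subset:
  assumes "m \<noteq> 0"
  shows "tri_points (Tri c m) \<subseteq> tri_points (Tri c (- 2 * m))"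
proof
  fix x assume x: "x \<in> tri_points (Tri c m)"
  define d where "d i = (coord i x - coord i c) / m" for i
  have d: "d 1 \<le> 1 / 3" "d 2 \<le> 1 / 3" "d 3 \<le> 1 / 3"
    using x unfolding mem_tri_points_iff[OF assms] d_def by simp_all
  have "d 1 + d 2 + d 3 = ((coord 1 x + coord 2 x + coord 3 x) - (coord 1 c + coord 2 c
    + coord 3 c)) / m"
    by (simp add: d_def diff_divide_distrib add_divide_distrib)
  then have "d 1 + d 2 + d 3 = 0"
    by (simp add: coord_sum)
  then have "- d i / 2 \<le> 1 / 3" if "i \<in> {1,2,3}" for i
    using that d by auto
  moreover have "- d i / 2 = (coord i x - coord i c) / of_int (- 2 * m)" for i
    by (simp add: d_def)
  ultimately have "(coord i x - coord i c) / of_int (- 2 * m) \<le> 1 / 3" if "i \<in> {1,2,3}" for i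
    using that by metis
  moreover have "- 2 * m \<noteq> 0" using assms by simp
  ultimately show "x \<in> tri_points (Tri c (- 2 * m))"
    using mem_tri_points_iff by blast
qed

lemma midsegments_double: "midsegments (aff_tri (- 2) 0 (Tri c r)) = sides (Tri (aff (- 2) 0 c) r)"
  using midsegments_eq_sides[of "aff (- 2) 0 c" r] by (simp add: aff_tri_def)

lemma midsegments_double_subset:
  assumes "tri_ratio U \<noteq> 0" "E \<in> midsegments (aff_tri (- 2) 0 U)"
  shows "E \<subseteq> tri_points (aff_tri (- 2) 0 U)"
proof -
  obtain c r where U: "U = Tri c r" by (cases U)
  then have "E \<subseteq> tri_points (Tri (aff (- 2) 0 c) r)"
    using assms(2) sides_subset_tri_points by (simp add: midsegments_double)
  also have "\<dots> \<subseteq> tri_points (Tri (aff (- 2) 0 c) (- 2 * r))"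
    using assms(1) U by (intro central_triangle_subset) simp
  finally show ?thesis
    by (simp add: U aff_tri_def)
qed

lemma central_triangle_coord:
  assumes "coord i c = of_int N - of_int r / 3"
  shows "coord i (aff (- 2) 0 c) = of_int (- 2 * N + r - 1) - of_int r / 3"
  using assms by (simp add: coord_double)

lemma central_triangle_grid:
  assumes "Tri c r \<in> grid_triangles"
  shows "Tri (aff (- 2) 0 c) r \<in> grid_triangles"
proof -
  obtain N where N: "\<And>i. i \<in> {1,2,3} \<Longrightarrow> coord i c = of_int (N i) - r / 3" and r: "\<bar>r\<bar> = 1"
    using assms by (auto simp: mem_grid_triangles_iff elim: alignedE)
  have "aligned (Tri (aff (- 2) 0 c) r)"
    by (rule alignedI[where N = "\<lambda>i. - 2 * N i + r - 1"]) (rule central_triangle_coord[OF N])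
  then show ?thesis
    using r by (simp add: mem_grid_triangles_iff)
qed

lemma midsegment_cells:
  assumes "U \<in> grid_triangles" "E' \<in> midsegments (aff_tri (- 2) 0 U)"
    and x: "edge_pt i (aff (- 2) 0 x)" "aff (- 2) 0 x \<in> E'"
  shows "E' \<in> grid_edges" "E' = cell (aff (- 2) 0 x)" "x \<notin> grid" "x \<in> tri_points U"
    "tri_ratio U = off_grid_ratio x"
proof -
  from assms(1) obtain c r N where U: "U = Tri c r" "r = 1 \<or> r = - 1"
    and N: "\<And>i. i \<in> {1,2,3} \<Longrightarrow> coord i c = of_int (N i) - r / 3"
    by (rule grid_trianglesE) blast
  have r0: "r \<noteq> 0" using U(2) by auto
  have \<tau>: "Tri (aff (- 2) 0 c) r \<in> grid_triangles"
    using central_triangle_grid assms(1) U(1) by blast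
  obtain l where l: "l \<in> {1,2,3}" and E': "E' = side (Tri (aff (- 2) 0 c) r) l"
    using assms(2) unfolding U(1) midsegments_double sides_def by blast
  show "E' \<in> grid_edges"
    unfolding grid_edges_def sides_def using \<tau> l E' by blast
  then show "E' = cell (aff (- 2) 0 x)"
    using grid_edge_eq_cell x by blast
  have "l = i"
    using side_eq_cell(1)[OF \<tau> l _ x(1)] x(2) E' by blast
  have "coord i (aff (- 2) 0 x) = coord i (aff (- 2) 0 c) + r / 3"
    using x(2) l unfolding E' \<open>l = i\<close> mem_side_iff[OF r0 l[unfolded \<open>l = i\<close>]] by blast
  then have xi: "coord i x = N i - r / 2"
    using N[of i] l \<open>l = i\<close> unfolding coord_double by simp
  show ng: "x \<notin> grid"
  proof
    assume "x \<in> grid"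
    from edge_pt_half[OF x(1) this] have "coord i x \<in> \<int>"
      by (rule edge_ptD)
    then obtain k where "N i - r / 2 = of_int k"
      unfolding xi by (rule Ints_cases)
    then have "real_of_int (2 * N i - r) = of_int (2 * k)" by simp
    then have "2 * N i - r = 2 * k" by linarith
    then show False using U(2) by presburger
  qed
  have "aff (- 2) 0 x \<in> tri_points (aff_tri (- 2) 0 U)"
    using midsegments_double_subset[OF _ assms(2)] x(2) U r0 by auto
  then show "x \<in> tri_points U"
    using inj_aff[of "- 2" 0] unfolding tri_points_aff_tri by (auto dest: injD)
  then show "tri_ratio U = off_grid_ratio x"
    using off_grid_cell(2) assms(1) ng by blast
qed

text \<open>Inside \<open>U\<close> the coordinate \<open>i\<close> ranges over an open interval of
  length \<open>1\<close>. Its image under \<open>- 2 a - 1\<close> has length \<open>2\<close> and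
  even integer midpoint or, shifted by the labels, in any case only one interior integer: the line
  of the midsegment. The remaining bounds follow from the coordinate sum.\<close>

lemma off_grid_midsegment:
  assumes "edge_pt i (aff (- 2) 0 x)" "x \<notin> grid" "U \<in> grid_triangles" "x \<in> tri_points U"
  shows "cell (aff (- 2) 0 x) \<in> midsegments (aff_tri (- 2) 0 U)"
proof -
  from assms(3) obtain c r N where U: "U = Tri c r" "r = 1 \<or> r = - 1"
    and N: "\<And>i. i \<in> {1,2,3} \<Longrightarrow> coord i c = of_int (N i) - r / 3" "N 1 + N 2 + N 3 = r - 1"
    by (rule grid_trianglesE) blast
  have r0: "r \<noteq> 0" using U(2) by auto
  have i: "i \<in> {1,2,3}" using edge_ptD(1)[OF assms(1)] .
  obtain j k where jk: "{i, j, k} = {1,2,3::nat}" "i \<noteq> j" "i \<noteq> k" "j \<noteq> k"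
    using i by (rule other_indicesE)
  then have jk_in: "j \<in> {1,2,3}" "k \<in> {1,2,3}" by blast+
  have Ns: "N i + N j + N k = r - 1"
    using coord_sum_perm[OF jk, of c] N(1)[OF i] N(1)[OF jk_in(1)] N(1)[OF jk_in(2)] by linarith
  define x' where "x' = aff (- 2) 0 x"
  have sx: "coord i x + coord j x + coord k x = - 1"
    by (rule coord_sum_perm[OF jk])
  have \<tau>: "Tri (aff (- 2) 0 c) r \<in> grid_triangles"
    using central_triangle_grid assms(3) U(1) by blast
  have lt: "r * coord l x < r * N l" if l: "l \<in> {1,2,3}" for l
  proof -
    have "(coord l x - coord l c) / r \<le> 1 / 3"
      using assms(4) l unfolding U(1) mem_tri_points_iff[OF r0] by blast
    then have "r * coord l x \<le> r * N l"
      using U(2) N(1)[OF l] by (elim disjE) simp_all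
    moreover have "coord l x \<noteq> N l"
      using assms(2) l unfolding mem_grid_iff by (metis Ints_of_int)
    ultimately show ?thesis using r0 by (simp add: order_less_le)
  qed
  obtain n where n: "coord i x' = of_int n"
    using edge_ptD(2)[OF assms(1)] unfolding x'_def by (rule Ints_cases)
  have x': "coord l x' = - 2 * coord l x - 1" for l
    unfolding x'_def by (rule coord_double)
  have "n = - 2 * N i + r - 1 \<and> (\<forall>l\<in>{i,j,k}. r * coord l x' \<le> r * (- 2 * N l + r - 1))"
    using U(2)
  proof
    assume r: "r = 1"
    have "coord i x < N i" "coord j x < N j" "coord k x < N k"
      using lt[OF i] lt[OF jk_in(1)] lt[OF jk_in(2)] r by auto
    moreover have Ns': "real_of_int (N i) + N j + N k = 0"
      using Ns r by linarith
    moreover have ni: "real_of_int n = - 2 * coord i x - 1" using n x' by simp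
    ultimately have "- 2 * real_of_int (N i) - 1 < n" "n < - 2 * real_of_int (N i) + 1"
      using sx by linarith+
    then have n': "n = - 2 * N i" by linarith
    then have "coord i x = N i - 1 / 2" using ni by simp
    then have "coord j x' \<le> - 2 * N j" "coord k x' \<le> - 2 * N k"
      using \<open>coord j x < N j\<close> \<open>coord k x < N k\<close> sx Ns' unfolding x' by linarith+
    then show ?thesis using r n n' by simp
  next
    assume r: "r = - 1"
    have "coord i x > N i" "coord j x > N j" "coord k x > N k"
      using lt[OF i] lt[OF jk_in(1)] lt[OF jk_in(2)] r by auto
    moreover have Ns': "real_of_int (N i) + N j + N k = - 2"
      using Ns r by linarith
    moreover have ni: "real_of_int n = - 2 * coord i x - 1" using n x' by simp
    ultimately have "- 2 * real_of_int (N i) - 3 < n" "n < - 2 * real_of_int (N i) - 1"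
      using sx by linarith+
    then have n': "n = - 2 * N i - 2" by linarith
    then have "coord i x = N i + 1 / 2" using ni by simp
    then have "coord j x' \<ge> - 2 * N j - 2" "coord k x' \<ge> - 2 * N k - 2"
      using \<open>coord j x > N j\<close> \<open>coord k x > N k\<close> sx Ns' unfolding x' by linarith+
    then show ?thesis using r n n' by simp
  qed
  then have mem: "n = - 2 * N i + r - 1" "\<And>l. l \<in> {1,2,3} \<Longrightarrow> r * coord l x' \<le> r * (- 2 * N l
    + r - 1)"
    unfolding jk(1) by blast+
  have "(coord l x' - coord l (aff (- 2) 0 c)) / r \<le> 1 / 3" if l: "l \<in> {1,2,3}" for l
    using mem(2)[OF l] U(2) unfolding central_triangle_coord[OF N(1)[OF l]]
    by (elim disjE) simp_all
  then have "x' \<in> side (Tri (aff (- 2) 0 c) r) i"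
    unfolding mem_side_iff[OF r0 i] mem_tri_points_iff[OF r0] central_triangle_coord[OF N(1)[OF i]]
    using n mem(1) by auto
  then have "side (Tri (aff (- 2) 0 c) r) i = cell x'"
    using side_eq_cell(2)[OF \<tau> i _ assms(1)] unfolding x'_def by blast
  then show ?thesis
    unfolding U(1) midsegments_double sides_def x'_def using i by blast
qed

subsection \<open>Folding\<close>

abbreviation paper :: "nat \<Rightarrow> triangle" where
  "paper k \<equiv> Tri 0 ((- 2) ^ k)"

definition inside :: "nat \<Rightarrow> complex \<Rightarrow> bool" where
  "inside k x \<longleftrightarrow> (\<forall>i\<in>{1,2,3}. x \<bullet> xi i / (- 2) ^ k < 1)"

lemma inner_xi: "x \<bullet> xi i = 3 * coord i x + 1"
  by (simp add: coord_def field_simps)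

lemma inner_xi_sum: "x \<bullet> xi 1 + x \<bullet> xi 2 + x \<bullet> xi 3 = 0"
  using coord_sum[of x] by (simp add: inner_xi)

lemma mem_paper_iff: "x \<in> tri_points (paper k) \<longleftrightarrow> (\<forall>i\<in>{1,2,3}. x \<bullet> xi i / (- 2) ^ k \<le> 1)"
proof -
  have "(coord i x - coord i 0) / of_int ((- 2) ^ k) \<le> 1 / 3 \<longleftrightarrow> x \<bullet> xi i / (- 2) ^ k \<le> 1" for i
  proof -
    have "(coord i x - coord i 0) / of_int ((- 2) ^ k) = (x \<bullet> xi i / (- 2) ^ k) / 3"
      by (simp add: coord_def diff_divide_distrib)
    moreover have "b / 3 \<le> 1 / 3 \<longleftrightarrow> b \<le> 1" for b :: real
      by simp
    ultimately show ?thesis by (simp only:)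
  qed
  moreover have "(- 2 :: int) ^ k \<noteq> 0"
    by simp
  ultimately show ?thesis
    using mem_tri_points_iff by blast
qed

lemma mem_paper_side_iff:
  assumes "i \<in> {1,2,3}"
  shows "x \<in> side (paper k) i \<longleftrightarrow> x \<in> tri_points (paper k) \<and> x \<bullet> xi i / (- 2) ^ k = 1"
proof -
  have "coord i x = coord i 0 + of_int ((- 2) ^ k) / 3 \<longleftrightarrow> x \<bullet> xi i / (- 2) ^ k = 1"
    by (auto simp: coord_def field_simps)
  then show ?thesis
    by (simp add: mem_side_iff[OF _ assms])
qed

lemma inside_iff: "inside k x \<longleftrightarrow> x \<in> tri_points (paper k) \<and> (\<forall>e\<in>sides (paper k). x \<notin> e)"
proof -
  have "(\<forall>e\<in>sides (paper k). x \<notin> e) \<longleftrightarrow> (\<forall>i\<in>{1,2,3}. x \<notin> side (paper k) i)"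
    by (auto simp: sides_def)
  then show ?thesis
    using mem_paper_iff[of x k] mem_paper_side_iff[of _ x k] unfolding inside_def
    by (metis order_less_le)
qed

lemma paper_Suc: "paper (Suc k) = aff_tri (- 2) 0 (paper k)"
  by (simp add: aff_tri_def aff_0)

lemma midsegments_paper_Suc: "midsegments (paper (Suc k)) = sides (paper k)"
  using midsegments_eq_sides[of 0 "(- 2) ^ k"] by simp

text \<open>Since \<open>- 2\<close> is \<open>1\<close> modulo \<open>3\<close>, the fold line
  \<open>x \<bullet> xi i = (- 2) ^ k\<close> is the grid line with index \<open>M\<close>.\<close>

lemma paper_line_int:
  obtains M :: int where "(- 2) ^ k = 3 * M + 1"
proof -
  have "\<exists>M::int. (- 2) ^ k = 3 * M + 1"
  proof (induction k)
    case (Suc k)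
    then obtain M :: int where "(- 2) ^ k = 3 * M + 1" by blast
    then have "(- 2) ^ Suc k = 3 * (- 2 * M - 1) + (1::int)" by simp
    then show ?case by blast
  qed simp
  then show ?thesis using that by blast
qed

lemma aligned_paper: "aligned (paper k)"
proof -
  obtain M :: int where "(- 2) ^ k = 3 * M + 1"
    by (rule paper_line_int)
  then show ?thesis
    by (simp add: aligned_def coord_def add_divide_distrib)
qed

lemma inside_Suc_double: "inside (Suc k) (aff (- 2) 0 x) \<longleftrightarrow> inside k x"
  by (simp add: inside_def aff_0)

lemma eventually_inside: "\<forall>\<^sub>F k in sequentially. inside k x"
proof -
  obtain B where B: "\<bar>x \<bullet> xi i\<bar> < B" if "i \<in> {1,2,3}" for i
  proof
    show "\<bar>x \<bullet> xi i\<bar> < \<bar>x \<bullet> xi 1\<bar> + \<bar>x \<bullet> xi 2\<bar> + \<bar>x \<bullet> xi 3\<bar> + 1" if "i \<in> {1,2,3}" for i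
      using that by auto
  qed
  obtain K where K: "B < 2 ^ K"
    using real_arch_pow[of 2 B] by auto
  have "inside k x" if "K \<le> k" for k
    unfolding inside_def
  proof
    fix i :: nat assume i: "i \<in> {1,2,3}"
    have "\<bar>x \<bullet> xi i / (- 2) ^ k\<bar> = \<bar>x \<bullet> xi i\<bar> / 2 ^ k"
      by (simp add: power_abs)
    also have "\<dots> < 1"
    proof -
      have "(2::real) ^ K \<le> 2 ^ k" using that by simp
      then have "\<bar>x \<bullet> xi i\<bar> < 2 ^ k" using B[OF i] K by linarith
      then show ?thesis by simp
    qed
    finally show "x \<bullet> xi i / (- 2) ^ k < 1" by linarith
  qed
  then show ?thesis
    unfolding eventually_sequentially by blast
qed

section \<open>Reflections in fold lines and the folding map on cells\<close>

lemma inner_reflect: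
  assumes "i \<in> {1,2,3}" "j \<in> {1,2,3}"
  shows "reflect i s x \<bullet> xi j = (if i = j then 2 * s - x \<bullet> xi i else x \<bullet> xi j + x \<bullet> xi i - s)"
proof -
  have "xi i \<bullet> xi i = 12" "xi i \<bullet> xi j = (if i = j then 12 else - 6)"
    using assms by (auto simp: xi_simps inner_complex_def)
  then show ?thesis
    by (simp add: reflect_def inner_diff_left field_simps)
qed

text \<open>In a grid line of family \<open>i\<close>, the reflection negates coordinate
  \<open>i\<close> and exchanges the other two with a change of sign, all up to integers; it
  therefore respects the grid.\<close>

lemma coord_reflect:
  assumes "{i, j, k} = {1,2,3}" "i \<noteq> j" "i \<noteq> k" "j \<noteq> k"
  shows "coord i (reflect i (3 * M + 1) x) = 2 * M - coord i x"
    and "coord j (reflect i (3 * M + 1) x) = - 1 - M - coord k x"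
    and "coord k (reflect i (3 * M + 1) x) = - 1 - M - coord j x"
proof -
  have in3: "i \<in> {1,2,3}" "j \<in> {1,2,3}" "k \<in> {1,2,3}" using assms(1) by blast+
  show "coord i (reflect i (3 * M + 1) x) = 2 * M - coord i x"
    unfolding coord_def inner_reflect[OF in3(1,1)] by (simp add: field_simps)
  show "coord j (reflect i (3 * M + 1) x) = - 1 - M - coord k x"
    using coord_sum_perm[OF assms, of x] assms(2)
    unfolding coord_def inner_reflect[OF in3(1,2)] by (simp add: field_simps)
  show "coord k (reflect i (3 * M + 1) x) = - 1 - M - coord j x"
    using coord_sum_perm[OF assms, of x] assms(3)
    unfolding coord_def inner_reflect[OF in3(1,3)] by (simp add: field_simps)
qed

lemma reflect_reflect:
  assumes "i \<in> {1,2,3}"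
  shows "reflect i s (reflect i s x) = x"
proof (rule coord_eqI)
  fix j :: nat assume j: "j \<in> {1,2,3}"
  show "coord j (reflect i s (reflect i s x)) = coord j x"
    unfolding coord_def inner_reflect[OF assms j] inner_reflect[OF assms assms] by simp
qed

lemma reflect_double: "reflect i (- 2 * s) (aff (- 2) 0 x) = aff (- 2) 0 (reflect i s x)"
  by (simp add: reflect_def aff_0 algebra_simps)

lemma fold_onto_double: "fold_onto (Suc k) (aff (- 2) 0 x) = aff (- 2) 0 (fold_onto k x)"
proof -
  have "(aff (- 2) 0 x \<bullet> xi i) / (- 2) ^ Suc k = (x \<bullet> xi i) / (- 2) ^ k" for i
    by (simp add: aff_0)
  then show ?thesis
    unfolding fold_onto_def Let_def by (simp only: power_Suc reflect_double if_distrib[of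
      "aff (- 2) 0"])
qed

lemma fold_onto_paper: "x \<in> tri_points (paper k) \<Longrightarrow> fold_onto k x = x"
  unfolding mem_paper_iff fold_onto_def Let_def by (simp add: not_less)

text \<open>All three normalized products are at least \<open>- 2\<close> and sum to
  \<open>0\<close>, so if one is at least \<open>1\<close> the others are at most \<open>1\<close>:
  the corners overlap at most in their fold lines. On the fold line the reflection is the identity,
  which gives the closed corner.\<close>

lemma fold_onto_corner:
  assumes "x \<in> tri_points (paper (Suc k))" "i \<in> {1,2,3}" "x \<bullet> xi i / (- 2) ^ k \<ge> 1"
  shows "fold_onto k x = reflect i ((- 2) ^ k) x"
proof -
  define s :: real where "s = (- 2) ^ k"
  have s0: "s \<noteq> 0" by (simp add: s_def)
  have ge: "x \<bullet> xi j / s \<ge> - 2" if "j \<in> {1,2,3}" for j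
    using assms(1) that unfolding mem_paper_iff s_def by force
  have sum: "x \<bullet> xi 1 / s + x \<bullet> xi 2 / s + x \<bullet> xi 3 / s = 0"
    using inner_xi_sum[of x] by (simp flip: add_divide_distrib)
  have le: "x \<bullet> xi j / s \<le> 1" if "j \<in> {1,2,3}" "j \<noteq> i" for j
    using that assms(2,3) sum ge[of 1] ge[of 2] ge[of 3] unfolding s_def[symmetric] by auto
  show ?thesis
  proof (cases "x \<bullet> xi i / s = 1")
    case True
    then have "x \<in> tri_points (paper k)"
      using le unfolding mem_paper_iff s_def[symmetric] by force
    moreover have "reflect i s x = x"
      using True s0 by (simp add: reflect_def)
    ultimately show ?thesis
      by (simp add: fold_onto_paper s_def)
  next
    case False
    then have "x \<bullet> xi i / s > 1"
      using assms(3) unfolding s_def by linarith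
    then show ?thesis
      using le[of 1] le[of 2] le[of 3] assms(2) unfolding fold_onto_def Let_def s_def[symmetric]
      by (auto simp: not_less[symmetric])
  qed
qed

lemma paper_Suc_cases:
  assumes "x \<in> tri_points (paper (Suc k))"
  obtains "x \<in> tri_points (paper k)" "fold_onto k x = x"
  | i where "i \<in> {1,2,3}" "x \<notin> tri_points (paper k)" "x \<bullet> xi i / (- 2) ^ k > 1"
      "fold_onto k x = reflect i ((- 2) ^ k) x"
proof (cases "x \<in> tri_points (paper k)")
  case True
  then show ?thesis using that(1) fold_onto_paper by blast
next
  case False
  then obtain i where i: "i \<in> {1,2,3}" "x \<bullet> xi i / (- 2) ^ k > 1"
    unfolding mem_paper_iff by (meson not_less)
  then show ?thesis
    using that(2)[OF i(1) False i(2)] fold_onto_corner[OF assms i(1)] by simp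
qed

lemma reflect_corner_bounds:
  assumes "i \<in> {1,2,3}" "j \<in> {1,2,3}"
  shows "reflect i ((- 2) ^ k) x \<bullet> xi j / (- 2) ^ k = (if i = j then 2 - x \<bullet> xi i / (- 2) ^ k
    else x \<bullet> xi j / (- 2) ^ k + x \<bullet> xi i / (- 2) ^ k - 1)"
  unfolding inner_reflect[OF assms] by (simp add: add_divide_distrib diff_divide_distrib)

lemma fold_onto_into:
  assumes "x \<in> tri_points (paper (Suc k))"
  shows "fold_onto k x \<in> tri_points (paper k)"
  using assms
proof (cases rule: paper_Suc_cases)
  case (2 i)
  define a where "a j = x \<bullet> xi j / (- 2) ^ k" for j
  have a: "a 1 \<ge> - 2" "a 2 \<ge> - 2" "a 3 \<ge> - 2"
    using assms unfolding mem_paper_iff a_def by (simp_all add: field_simps)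
  have "a 1 + a 2 + a 3 = 0"
    using inner_xi_sum[of x] by (simp add: a_def flip: add_divide_distrib)
  moreover have "a i > 1" using 2(3) by (simp add: a_def)
  ultimately have "(if i = j then 2 - a i else a j + a i - 1) \<le> 1" if "j \<in> {1,2,3}" for j
    using that 2(1) a by auto
  then show ?thesis
    unfolding mem_paper_iff 2(4) a_def using reflect_corner_bounds[OF 2(1)] by simp
qed simp

lemma fold_onto_inside:
  assumes "inside (Suc k) x" "\<forall>e\<in>sides (paper k). x \<notin> e"
  shows "inside k (fold_onto k x)"
proof -
  have "x \<in> tri_points (paper (Suc k))"
    using assms(1) by (simp only: inside_iff)
  then show ?thesis
  proof (cases rule: paper_Suc_cases)
    case 1
    then show ?thesis
      using assms(2) by (simp only: inside_iff)
  next
    case (2 i)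
    define a where "a j = x \<bullet> xi j / (- 2) ^ k" for j
    have a: "a 1 > - 2" "a 2 > - 2" "a 3 > - 2"
      using assms(1) unfolding inside_def a_def by (simp_all add: field_simps)
    have "a 1 + a 2 + a 3 = 0"
      using inner_xi_sum[of x] by (simp add: a_def flip: add_divide_distrib)
    moreover have "a i > 1" using 2(3) by (simp add: a_def)
    ultimately have "(if i = j then 2 - a i else a j + a i - 1) < 1" if "j \<in> {1,2,3}" for j
      using that 2(1) a by auto
    then show ?thesis
      unfolding inside_def 2(4) a_def using reflect_corner_bounds[OF 2(1)] by simp
  qed
qed

lemma reflect_cell_subset:
  assumes "i \<in> {1,2,3}"
  shows "reflect i (3 * of_int M + 1) ` cell x \<subseteq> cell (reflect i (3 * of_int M + 1) x)"
proof clarify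
  fix y assume y: "y \<in> cell x"
  obtain j k where jk: "{i, j, k} = {1,2,3::nat}" "i \<noteq> j" "i \<noteq> k" "j \<noteq> k"
    using assms by (rule other_indicesE)
  have y': "\<forall>l\<in>{i,j,k}. of_int \<lfloor>coord l x\<rfloor> \<le> coord l y \<and> coord l y \<le> of_int \<lceil>coord l x\<rceil>"
    using y unfolding cell_def jk(1) by blast
  have fl: "\<lfloor>of_int n - a\<rfloor> = n - \<lceil>a\<rceil>" "\<lceil>of_int n - a\<rceil> = n - \<lfloor>a\<rfloor>" for n and a :: real
    by linarith+
  have "of_int \<lfloor>of_int n - a\<rfloor> \<le> of_int n - b \<and> of_int n - b \<le> of_int \<lceil>of_int n - a\<rceil>"
    if "of_int \<lfloor>a\<rfloor> \<le> b \<and> b \<le> of_int \<lceil>a\<rceil>" for n and a b :: real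
    using that unfolding fl by simp
  from this[of "coord i x" "coord i y" "2 * M"] this[of "coord j x" "coord j y" "- 1 - M"]
    this[of "coord k x" "coord k y" "- 1 - M"]
  have "\<forall>l\<in>{i,j,k}. of_int \<lfloor>coord l (reflect i (3 * of_int M
    + 1) x)\<rfloor> \<le> coord l (reflect i (3 * of_int M + 1) y)
      \<and> coord l (reflect i (3 * of_int M + 1) y) \<le> of_int \<lceil>coord l (reflect i (3 * of_int M
        + 1) x)\<rceil>"
    using y' by (simp add: coord_reflect[OF jk])
  then show "reflect i (3 * of_int M + 1) y \<in> cell (reflect i (3 * of_int M + 1) x)"
    unfolding cell_def jk(1) by blast
qed

lemma reflect_cell:
  assumes "i \<in> {1,2,3}"
  shows "reflect i (3 * of_int M + 1) ` cell x = cell (reflect i (3 * of_int M + 1) x)"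
proof
  let ?\<rho> = "reflect i (3 * of_int M + 1)"
  show "cell (?\<rho> x) \<subseteq> ?\<rho> ` cell x"
  proof
    fix y assume "y \<in> cell (?\<rho> x)"
    then have "?\<rho> y \<in> cell (?\<rho> (?\<rho> x))"
      using reflect_cell_subset[OF assms] by blast
    then show "y \<in> ?\<rho> ` cell x"
      using reflect_reflect[OF assms] by (metis imageI)
  qed
qed (rule reflect_cell_subset[OF assms])

text \<open>The fold lines are grid lines, so the whole cell lies in the central triangle or in one
  closed corner, and the folding map acts on it as the identity or as a single reflection.\<close>

lemma fold_onto_cell:
  assumes "x \<in> tri_points (paper (Suc k))"
  shows "fold_onto k ` cell x = cell (fold_onto k x)"
  using assms
proof (cases rule: paper_Suc_cases)
  case 1
  have "cell x \<subseteq> tri_points (paper k)"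
    by (rule cell_subset_tri_points) (use 1 aligned_paper in auto)
  then have "fold_onto k y = y" if "y \<in> cell x" for y
    using that fold_onto_paper by blast
  then show ?thesis
    using 1(2) by simp
next
  case (2 i)
  obtain M :: int where M: "(- 2) ^ k = 3 * M + 1"
    by (rule paper_line_int)
  then have Mr: "(- 2 :: real) ^ k = 3 * of_int M + 1"
    by (metis (mono_tags) of_int_1 of_int_add of_int_minus of_int_mult of_int_numeral of_int_power)
  have sub: "cell x \<subseteq> tri_points (paper (Suc k))"
    by (rule cell_subset_tri_points[OF aligned_paper _ assms]) simp
  have "y \<bullet> xi i / (- 2) ^ k \<ge> 1" if y: "y \<in> cell x" for y
  proof -
    have y: "of_int \<lfloor>coord i x\<rfloor> \<le> coord i y" "coord i y \<le> of_int \<lceil>coord i x\<rceil>"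
      using y 2(1) unfolding cell_def by blast+
    show ?thesis
    proof (cases "(- 2 :: real) ^ k > 0")
      case True
      then have "coord i x > M"
        using 2(3) unfolding inner_xi Mr by (simp add: field_simps)
      then have "M \<le> \<lfloor>coord i x\<rfloor>" by linarith
      then have "M \<le> coord i y" using y by linarith
      then show ?thesis
        using True unfolding inner_xi Mr by (simp add: field_simps)
    next
      case False
      then have neg: "(- 2 :: real) ^ k < 0"
        by (metis linorder_neqE_linordered_idom neg_equal_0_iff_equal power_not_zero
          zero_neq_numeral)
      then have "coord i x < M"
        using 2(3) unfolding inner_xi Mr by (simp add: field_simps)
      then have "\<lceil>coord i x\<rceil> \<le> M" by linarith
      then have "coord i y \<le> M" using y by linarith
      then show ?thesis
        using neg unfolding inner_xi Mr by (simp add: field_simps)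
    qed
  qed
  then have "fold_onto k y = reflect i ((- 2) ^ k) y" if "y \<in> cell x" for y
    using that sub fold_onto_corner[OF _ 2(1)] by blast
  then have "fold_onto k ` cell x = reflect i ((- 2) ^ k) ` cell x"
    by (rule image_cong[OF refl])
  then show ?thesis
    unfolding 2(4) Mr reflect_cell[OF 2(1)] .
qed

text \<open>Each test made along the recursion gives the same answer for a cell as for its point,
  since sides of paper triangles and the triangles themselves contain the whole cell of each of
  their points.\<close>

lemma crease_color_cell:
  assumes "x \<in> tri_points (paper k)"
  shows "crease_color a k up (cell x) = crease_color a k up {x}"
  using assms
proof (induction k arbitrary: x up)
  case (Suc k)
  have nz: "tri_ratio (paper k) \<noteq> 0" by simp
  have 1: "(\<exists>s\<in>sides (paper k). cell x \<subseteq> s) \<longleftrightarrow> (\<exists>s\<in>sides (paper k). {x} \<subseteq> s)"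
    using cell_subset_side[OF aligned_paper nz] mem_cell_self[of x] unfolding sides_def by blast
  have 2: "cell x \<subseteq> tri_points (paper k) \<longleftrightarrow> {x} \<subseteq> tri_points (paper k)"
    using cell_subset_tri_points[OF aligned_paper nz] mem_cell_self[of x] by blast
  have 3: "fold_onto k ` cell x = cell (fold_onto k x)"
    by (rule fold_onto_cell[OF Suc.prems])
  show ?case
    unfolding crease_color.simps midsegments_paper_Suc 1 2 3 Suc.IH[OF fold_onto_into[OF Suc.prems]]
      by simp
qed simp

section \<open>Creases at points when all foldings go up\<close>

declare crease_color.simps(2) [simp del]

text \<open>Constancy of the sequence makes the color rule independent of the level, which allows
  levels to be shifted.\<close>

lemma crease_color_Suc:
  assumes "\<forall>i\<ge>1. S i = Up"
  shows "crease_color S (Suc k) up {x} =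
    (if \<exists>s\<in>sides (paper k). x \<in> s then Some (if up then Red else Blue)
     else crease_color S k (if x \<in> tri_points (paper k) then up else \<not> up) {fold_onto k x})"
  unfolding crease_color.simps(2) midsegments_paper_Suc using assms by simp

text \<open>Level \<open>Suc k\<close> at the inflated point repeats level \<open>k\<close> at
  \<open>x\<close>, by \<open>fold_onto_double\<close>. The base case is vacuous: at level
  \<open>0\<close> there is no color.\<close>

lemma crease_color_double:
  assumes up: "\<forall>i\<ge>1. S i = Up" and "crease_color S k up {x} = Some c"
  shows "crease_color S (Suc k) up {aff (- 2) 0 x} = Some c"
  using assms(2)
proof (induction k arbitrary: x up)
  case (Suc k)
  have inj: "aff (- 2) 0 x \<in> aff (- 2) 0 ` A \<longleftrightarrow> x \<in> A" for A
    using inj_aff[of "- 2" 0] by (simp add: inj_image_mem_iff)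
  have 1: "(\<exists>s\<in>sides (paper (Suc k)). aff (- 2) 0 x \<in> s) \<longleftrightarrow> (\<exists>s\<in>sides (paper k). x \<in> s)"
    unfolding paper_Suc sides_aff_tri by (simp add: inj)
  have 2: "aff (- 2) 0 x \<in> tri_points (paper (Suc k)) \<longleftrightarrow> x \<in> tri_points (paper k)"
    unfolding paper_Suc tri_points_aff_tri by (simp add: inj)
  show ?case
    unfolding crease_color_Suc[OF up, of "Suc k"] 1 2 fold_onto_double
    using Suc.prems[unfolded crease_color_Suc[OF up, of k]] Suc.IH
    by (cases up; auto split: if_splits)
qed simp

text \<open>Integrality is preserved by \<open>coord_reflect\<close>. The sign change turns rounding
  down into rounding up, which interchanges the floor sums \<open>- 3\<close> and
  \<open>- 2\<close>, that is the two orientations.\<close>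

lemma reflect_grid:
  assumes "i \<in> {1,2,3}"
  shows "reflect i ((- 2) ^ k) x \<in> grid \<longleftrightarrow> x \<in> grid"
    and "edge_pt l x \<Longrightarrow> \<exists>l'. edge_pt l' (reflect i ((- 2) ^ k) x)"
    and "x \<notin> grid \<Longrightarrow> off_grid_ratio (reflect i ((- 2) ^ k) x) = - off_grid_ratio x"
proof -
  obtain M :: int where M: "(- 2) ^ k = 3 * M + 1"
    by (rule paper_line_int)
  then have Mr: "(- 2 :: real) ^ k = 3 * of_int M + 1"
    by (metis (mono_tags) of_int_1 of_int_add of_int_minus of_int_mult of_int_numeral of_int_power)
  obtain j m where jm: "{i, j, m} = {1,2,3::nat}" "i \<noteq> j" "i \<noteq> m" "j \<noteq> m"
    using assms by (rule other_indicesE)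
  define y where "y = reflect i ((- 2) ^ k) x"
  have y: "coord i y = of_int (2 * M) - coord i x" "coord j y = of_int (- 1 - M) - coord m x"
    "coord m y = of_int (- 1 - M) - coord j x"
    using coord_reflect[OF jm, of "of_int M" x] unfolding y_def Mr by simp_all
  have Ints: "of_int n - a \<in> \<int> \<longleftrightarrow> a \<in> \<int>" for n and a :: real
    using Ints_diff[of "of_int n" "of_int n - a"] Ints_diff[of "of_int n" a] by auto
  have yI: "coord i y \<in> \<int> \<longleftrightarrow> coord i x \<in> \<int>" "coord j y \<in> \<int> \<longleftrightarrow> coord m x \<in> \<int>"
    "coord m y \<in> \<int> \<longleftrightarrow> coord j x \<in> \<int>"
    unfolding y Ints by simp_all
  show "y \<in> grid \<longleftrightarrow> x \<in> grid"
    unfolding mem_grid_iff jm(1)[symmetric] using yI by auto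
  show "\<exists>l'. edge_pt l' y" if "edge_pt l x"
  proof -
    have "edge_pt (if l = i then i else if l = j then m else j) y"
      using that yI jm(2-) unfolding edge_pt_def jm(1)[symmetric] by auto
    then show ?thesis by blast
  qed
  show "off_grid_ratio y = - off_grid_ratio x" if "x \<notin> grid"
  proof -
    have fl: "\<lfloor>of_int n - a\<rfloor> = n - 1 - \<lfloor>a\<rfloor>" if "a \<notin> \<int>" for n and a :: real
      using not_Ints_strict(1,2)[OF that] by linarith
    have ni: "coord i x \<notin> \<int>" "coord j x \<notin> \<int>" "coord m x \<notin> \<int>"
      using that unfolding mem_grid_iff jm(1)[symmetric] by simp_all
    have sum: "\<lfloor>coord 1 z\<rfloor> + \<lfloor>coord 2 z\<rfloor> + \<lfloor>coord 3 z\<rfloor> = \<lfloor>coord i z\<rfloor> + \<lfloor>coord j z\<rfloor> + \<lfloor>coord m z\<rfloor>"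
      for z
    proof -
      have "\<lfloor>coord 1 z\<rfloor> + \<lfloor>coord 2 z\<rfloor> + \<lfloor>coord 3 z\<rfloor> = (\<Sum>l\<in>{i,j,m}. \<lfloor>coord l z\<rfloor>)"
        unfolding jm(1) by simp
      then show ?thesis using jm(2-) by simp
    qed
    \<comment> \<open>The shifts add up to \<open>2 M - 2 (1 + M) = - 2\<close>, and each of the
      three floors of a negated non-integer contributes another \<open>- 1\<close>.\<close>
    have "\<lfloor>coord i y\<rfloor> + \<lfloor>coord j y\<rfloor> + \<lfloor>coord m y\<rfloor> = - 5 - (\<lfloor>coord i x\<rfloor> + \<lfloor>coord j x\<rfloor> + \<lfloor>coord m x\<rfloor>)"
      unfolding y fl[OF ni(1)] fl[OF ni(2)] fl[OF ni(3)] by simp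
    then show ?thesis
      using floor_coord_sum[OF that] unfolding off_grid_ratio_def sum by auto
  qed
qed

text \<open>A midsegment of \<open>-2 U\<close>, with \<open>U\<close> a unit triangle, is creased when \<open>U\<close> has been folded onto
  \<open>T\<^sub>0\<close>. Each reflection on the way turns the paper over and changes the orientation of \<open>U\<close>.\<close>

lemma crease_color_midsegment:
  assumes up: "\<forall>i\<ge>1. S i = Up"
    and "x \<in> tri_points (paper k)" "x \<notin> grid" "edge_pt l (aff (- 2) 0 x)"
  shows "crease_color S (Suc k) up {aff (- 2) 0 x} = Some (if (off_grid_ratio x = 1) = up then Red
    else Blue)"
  using assms(2-)
proof (induction k arbitrary: x l up)
  case 0
  have T0: "T0 \<in> grid_triangles"
    using aligned_paper[of 0] by (simp add: mem_grid_triangles_iff)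
  have x: "x \<in> tri_points T0" using 0(1) by simp
  have "off_grid_ratio x = 1"
    using off_grid_cell(2)[OF T0 x 0(2)] by simp
  moreover have "\<exists>s\<in>sides (paper 0). aff (- 2) 0 x \<in> s"
    using off_grid_midsegment[OF 0(3) 0(2) T0 x] mem_cell_self paper_Suc[of 0]
    unfolding midsegments_paper_Suc[symmetric] by auto
  ultimately show ?case
    unfolding crease_color_Suc[OF up] by simp
next
  case (Suc k)
  have inj: "aff (- 2) 0 x \<in> aff (- 2) 0 ` A \<longleftrightarrow> x \<in> A" for A
    using inj_aff[of "- 2" 0] by (simp add: inj_image_mem_iff)
  have "\<not> (\<exists>s\<in>sides (paper k). x \<in> s)"
  proof
    assume "\<exists>s\<in>sides (paper k). x \<in> s"
    then obtain i where i: "i \<in> {1,2,3}" "x \<in> side (paper k) i"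
      unfolding sides_def by blast
    then have "coord i x = coord i 0 + of_int ((- 2) ^ k) / 3"
      using mem_side_iff[of "(- 2) ^ k" i x 0] by simp
    then show False
      using Suc.prems(2) i(1) aligned_paper[of k] unfolding aligned_def mem_grid_iff by force
  qed
  then have 1: "\<not> (\<exists>s\<in>sides (paper (Suc k)). aff (- 2) 0 x \<in> s)"
    unfolding paper_Suc sides_aff_tri by (simp add: inj)
  have 2: "aff (- 2) 0 x \<in> tri_points (paper (Suc k)) \<longleftrightarrow> x \<in> tri_points (paper k)"
    unfolding paper_Suc tri_points_aff_tri by (simp add: inj)
  from Suc.prems(1) show ?case
  proof (cases rule: paper_Suc_cases)
    case c: 1
    show ?thesis
      unfolding crease_color_Suc[OF up, of "Suc k"] 2 fold_onto_double
      using 1 c Suc.IH[OF c(1) Suc.prems(2,3)] by simp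
  next
    case c: (2 i)
    have "fold_onto (Suc k) (aff (- 2) 0 x) = reflect i ((- 2) ^ Suc k) (aff (- 2) 0 x)"
      unfolding fold_onto_double c(4) by (simp only: power_Suc reflect_double)
    then obtain l' where l': "edge_pt l' (aff (- 2) 0 (fold_onto k x))"
      using reflect_grid(2)[OF c(1) Suc.prems(3)] unfolding fold_onto_double by metis
    have "fold_onto k x \<notin> grid" "off_grid_ratio (fold_onto k x) = - off_grid_ratio x"
      using reflect_grid(1,3)[OF c(1)] Suc.prems(2) unfolding c(4) by blast+
    \<comment> \<open>Orientation and upper face are reversed together, so the truth value of
      \<open>(off_grid_ratio x = 1) = up\<close> survives the reflection.\<close>
    moreover have "off_grid_ratio x = 1 \<or> off_grid_ratio x = - 1"
      by (simp add: off_grid_ratio_def)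
    ultimately show ?thesis
      unfolding crease_color_Suc[OF up, of "Suc k"] 2 fold_onto_double
      using 1 c(2) Suc.IH[OF fold_onto_into[OF Suc.prems(1)] _ l', of "\<not> up"] by auto
  qed
qed

text \<open>A point that meets no crease stays strictly inside all the folded papers down to
  \<open>T0\<close>, and the interior of \<open>T0\<close> contains no point of a grid edge.\<close>

lemma crease_color_exists:
  assumes up: "\<forall>i\<ge>1. S i = Up" and "inside k x" "edge_pt i x"
  shows "\<exists>c. crease_color S k up {x} = Some c"
  using assms(2,3)
proof (induction k arbitrary: x i up)
  case 0
  obtain n where n: "coord i x = of_int n"
    using edge_ptD(2)[OF 0(2)] by (rule Ints_cases)
  obtain j k where jk: "{i, j, k} = {1,2,3::nat}" "i \<noteq> j" "i \<noteq> k" "j \<noteq> k"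
    using edge_ptD(1)[OF 0(2)] by (rule other_indicesE)
  \<comment> \<open>All coordinates being negative, the integral one is at most \<open>- 1\<close>,
    and the sum falls below \<open>- 1\<close>.\<close>
  have "\<forall>l\<in>{i,j,k}. coord l x < 0"
    using 0(1) unfolding inside_def inner_xi jk(1) by simp
  then have "n \<le> - 1" "coord j x < 0" "coord k x < 0"
    using n by auto
  then have False
    using coord_sum_perm[OF jk, of x] n by linarith
  then show ?case ..
next
  case (Suc k)
  show ?case
  proof (cases "\<exists>s\<in>sides (paper k). x \<in> s")
    case True
    then show ?thesis
      unfolding crease_color_Suc[OF up] by simp
  next
    case False
    then have ins: "inside k (fold_onto k x)"
      using fold_onto_inside[OF Suc.prems(1)] by blast
    have "x \<in> tri_points (paper (Suc k))"
      using Suc.prems(1) by (simp only: inside_iff)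
    then obtain i' where i': "edge_pt i' (fold_onto k x)"
      by (cases rule: paper_Suc_cases) (use Suc.prems(2) reflect_grid(2) in metis)+
    then show ?thesis
      unfolding crease_color_Suc[OF up] using False Suc.IH[OF ins] by simp
  qed
qed

text \<open>Inside \<open>paper k\<close> the folding from \<open>paper (Suc k)\<close> neither
  moves the point, turns it over nor creases it.\<close>

lemma crease_color_mono:
  assumes up: "\<forall>i\<ge>1. S i = Up" and "inside k x" "k \<le> k'"
  shows "inside k' x \<and> crease_color S k' up {x} = crease_color S k up {x}"
  using assms(3)
proof (induction k' rule: dec_induct)
  case (step n)
  have n: "x \<in> tri_points (paper n)" "\<forall>e\<in>sides (paper n). x \<notin> e"
    using step.IH unfolding inside_iff by blast+
  have "x \<bullet> xi i / (- 2) ^ Suc n < 1" if "i \<in> {1,2,3}" for i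
  proof -
    define a where "a j = x \<bullet> xi j / (- 2) ^ n" for j
    have "a 1 + a 2 + a 3 = 0"
      using inner_xi_sum[of x] by (simp add: a_def flip: add_divide_distrib)
    moreover have "a 1 < 1" "a 2 < 1" "a 3 < 1"
      using step.IH unfolding inside_def a_def by simp_all
    ultimately have "a i > - 2" using that by auto
    moreover have "x \<bullet> xi i / (- 2) ^ Suc n = - a i / 2"
      by (simp add: a_def)
    ultimately show ?thesis by linarith
  qed
  moreover have "crease_color S (Suc n) up {x} = crease_color S n up {x}"
    unfolding crease_color_Suc[OF up] using n by (simp add: fold_onto_paper)
  ultimately show ?case
    using step.IH unfolding inside_def by simp
qed (use assms in simp)

section \<open>The limit pattern and its behavior under inflation by \<open>- 2\<close>\<close>

lemma edge_interior_to_iff: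
  assumes "edge_pt i x"
  shows "edge_interior_to (cell x) (paper k) \<longleftrightarrow> inside k x"
proof
  have nz: "tri_ratio (paper k) \<noteq> 0" by simp
  {
    assume *: "edge_interior_to (cell x) (paper k)"
    then have "x \<in> tri_points (paper k)"
      using mem_cell_self unfolding edge_interior_to_def by blast
    moreover have "x \<notin> e" if e: "e \<in> sides (paper k)" for e
    proof
      assume "x \<in> e"
      from e obtain j where j: "j \<in> {1,2,3}" "e = side (paper k) j"
        unfolding sides_def by blast
      \<comment> \<open>The triangle lies in the closed half-plane bounded by the line of the side,
        so a point of the side cannot be interior.\<close>
      have "e \<subseteq> frontier (tri_points (paper k))"
      proof
        fix y assume "y \<in> e"
        then have y: "y \<in> tri_points (paper k)" "y \<bullet> xi j / (- 2) ^ k = 1"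
          using mem_paper_side_iff[OF j(1)] j(2) by blast+
        define a where "a = (1 / (- 2) ^ k) *\<^sub>R xi j"
        have "xi j \<noteq> 0" using j(1) by (auto simp: xi_simps complex_eq_iff)
        then have a0: "a \<noteq> 0" by (simp add: a_def)
        have a: "a \<bullet> z = z \<bullet> xi j / (- 2) ^ k" for z
          by (simp add: a_def inner_commute)
        have "tri_points (paper k) \<subseteq> {z. a \<bullet> z \<le> 1}"
          using j(1) unfolding a by (auto simp: mem_paper_iff)
        then have "interior (tri_points (paper k)) \<subseteq> {z. a \<bullet> z < 1}"
          using interior_mono interior_halfspace_le[OF a0] by metis
        then have "y \<notin> interior (tri_points (paper k))"
          using a[of y, unfolded y(2)] by auto
        then show "y \<in> frontier (tri_points (paper k))"
          unfolding frontier_def using y(1) closure_subset by blast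
      qed
      moreover have "cell x \<subseteq> e"
        using cell_subset_side[OF aligned_paper nz j(1)] \<open>x \<in> e\<close> j(2) by blast
      ultimately show False
        using * unfolding edge_interior_to_def by blast
    qed
    ultimately show "inside k x"
      unfolding inside_iff by blast
  next
    assume ins: "inside k x"
    then have "cell x \<subseteq> tri_points (paper k)"
      using cell_subset_tri_points[OF aligned_paper nz] unfolding inside_iff by blast
    moreover have "open {z. inside k z}"
      unfolding inside_def by (simp add: open_Collect_conj open_Collect_less continuous_intros)
    then have "{z. inside k z} \<subseteq> interior (tri_points (paper k))"
      by (rule interior_maximal[rotated]) (use inside_iff in blast)
    then have "x \<notin> frontier (tri_points (paper k))"
      using ins unfolding frontier_def by blast
    ultimately show "edge_interior_to (cell x) (paper k)"
      unfolding edge_interior_to_def using mem_cell_self by blast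
  }
qed

text \<open>One level decides the color: any other admissible level is compared with it at the
  larger of the two, so the definite description has a unique value.\<close>

lemma folding_pattern_cell:
  assumes up: "\<forall>i\<ge>1. S i = Up"
    and "edge_pt i x" "inside k x" "crease_color S k True {x} = Some c"
  shows "folding_pattern S (cell x) = Some c"
proof -
  have *: "finite_pattern S k' (cell x) = Some c" if "edge_interior_to (cell x) (paper k')" for k'
  proof -
    have ins: "inside k' x"
      using that edge_interior_to_iff[OF assms(2)] by blast
    then have "finite_pattern S k' (cell x) = crease_color S k' True {x}"
      unfolding finite_pattern_def by (intro crease_color_cell) (simp only: inside_iff)
    also have "\<dots> = crease_color S (max k k') True {x}"
      using crease_color_mono[OF up ins, of "max k k'"] by simp
    also have "\<dots> = crease_color S k True {x}"
      using crease_color_mono[OF up assms(3), of "max k k'"] by simp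
    finally show ?thesis using assms(4) by simp
  qed
  moreover have "edge_interior_to (cell x) (paper k)"
    using edge_interior_to_iff[OF assms(2)] assms(3) by blast
  ultimately have "(THE c. \<forall>k. edge_interior_to (cell x) (paper k) \<longrightarrow> finite_pattern S k (cell x)
    = Some c) = c"
    by (intro the_equality) (blast, metis option.inject)
  then show ?thesis
    unfolding folding_pattern_def using cell_grid_edge[OF assms(2)] by simp
qed

lemma folding_pattern_half_edge:
  assumes up: "\<forall>i\<ge>1. S i = Up" and E: "E \<in> grid_edges" "E' \<in> grid_edges" "E' \<subseteq> aff (- 2) 0 ` E"
  shows "folding_pattern S E' = folding_pattern S E"
proof -
  obtain i x' where x': "edge_pt i x'" "x' \<in> E'"
    using grid_edge_generic_point[OF E(2)] by blast
  obtain x where x: "x' = aff (- 2) 0 x"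
    by (rule double_surj)
  note cells = half_edge_cells[OF E x'[unfolded x]]
  obtain k where k: "inside k x"
    using eventually_happens[OF eventually_inside] by auto
  obtain c where c: "crease_color S k True {x} = Some c"
    using crease_color_exists[OF up k cells(1)] by blast
  have "folding_pattern S E' = Some c"
    unfolding cells(3)
    by (rule folding_pattern_cell[OF up, of _ _ "Suc k"])
      (use x'(1) x k inside_Suc_double crease_color_double[OF up c] in auto)
  moreover have "folding_pattern S E = Some c"
    unfolding cells(2) by (rule folding_pattern_cell[OF up cells(1) k c])
  ultimately show ?thesis by simp
qed

lemma folding_pattern_midsegment:
  assumes up: "\<forall>i\<ge>1. S i = Up" and U: "U \<in> grid_triangles" "E' \<in> midsegments (aff_tri (- 2) 0 U)"
  shows "E' \<in> grid_edges" "folding_pattern S E' = Some (if tri_ratio U > 0 then Red else Blue)"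
proof -
  obtain c r where c: "U = Tri c r" by (cases U)
  have "E' \<in> sides (Tri (aff (- 2) 0 c) r)"
    using U(2) unfolding c midsegments_double .
  then show E': "E' \<in> grid_edges"
    using central_triangle_grid[of c r] U(1) unfolding c grid_edges_def by blast
  obtain i x' where x': "edge_pt i x'" "x' \<in> E'"
    using grid_edge_generic_point[OF E'] by blast
  obtain x where x: "x' = aff (- 2) 0 x"
    by (rule double_surj)
  note cells = midsegment_cells[OF U x'[unfolded x]]
  obtain k where k: "inside k x"
    using eventually_happens[OF eventually_inside] by auto
  have "x \<in> tri_points (paper k)"
    using k by (simp only: inside_iff)
  from crease_color_midsegment[OF up this cells(3) x'(1)[unfolded x], of True]
  have "crease_color S (Suc k) True {aff (- 2) 0 x} = Some (if off_grid_ratio x = 1 then Red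
    else Blue)"
    by simp
  then have "folding_pattern S E' = Some (if off_grid_ratio x = 1 then Red else Blue)"
    unfolding cells(2)
    by (rule folding_pattern_cell[OF up x'(1)[unfolded x], rotated]) (use k inside_Suc_double in
      blast)
  moreover have "off_grid_ratio x = 1 \<longleftrightarrow> tri_ratio U > 0"
    unfolding cells(5) by (simp add: off_grid_ratio_def)
  ultimately show "folding_pattern S E' = Some (if tri_ratio U > 0 then Red else Blue)"
    by simp
qed

subsection \<open>The substitutions\<close>

text \<open>An interior point of the edge is pulled back by the inflation. If the result is on the
  grid, the edge is half of an inflated edge; otherwise it lies inside some unit triangle and the
  edge is a midsegment.\<close>

lemma double_edge_cases:
  assumes "aligned t" "tri_ratio t \<noteq> 0" "E' \<in> grid_edges" "E' \<subseteq> tri_points (aff_tri (- 2) 0 t)"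
  obtains E where "E \<in> grid_edges" "E \<subseteq> tri_points t" "E' \<subseteq> aff (- 2) 0 ` E"
  | U where "U \<in> grid_triangles" "tri_points U \<subseteq> tri_points t" "E'
    \<in> midsegments (aff_tri (- 2) 0 U)"
proof -
  obtain i x' where x': "edge_pt i x'" "x' \<in> E'"
    using grid_edge_generic_point[OF assms(3)] by blast
  obtain x where x: "x' = aff (- 2) 0 x"
    by (rule double_surj)
  have E': "E' = cell (aff (- 2) 0 x)"
    using grid_edge_eq_cell[OF assms(3) x'(2,1)] x by blast
  have "aff (- 2) 0 x \<in> aff (- 2) 0 ` tri_points t"
    using assms(4) x'(2) x unfolding tri_points_aff_tri by blast
  then have xt: "x \<in> tri_points t"
    using inj_aff[of "- 2" 0] by (simp add: inj_image_mem_iff)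
  then have cell: "cell x \<subseteq> tri_points t"
    by (rule cell_subset_tri_points[OF assms(1,2)])
  show ?thesis
  proof (cases "x \<in> grid")
    case True
    then have "edge_pt i x"
      using edge_pt_half x'(1) x by blast
    then show ?thesis
      using that(1)[of "cell x"] cell_grid_edge cell cell_double E' by blast
  next
    case False
    obtain U where U: "U \<in> grid_triangles" "x \<in> tri_points U"
      using off_grid_triangle[OF False] by blast
    then have "tri_points U \<subseteq> tri_points t"
      using off_grid_cell(1)[OF U False] cell by simp
    then show ?thesis
      using that(2)[OF U(1)] off_grid_midsegment[OF x'(1)[unfolded x] False U] E' by blast
  qed
qed

text \<open>Sign \<open>- 1\<close> only exchanges the colors; the rotation by \<open>\<pi>\<close>
  that accompanies it is part of the placement \<open>aff s w\<close>.\<close>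

definition signed_pattern :: "(complex set \<Rightarrow> color option) \<Rightarrow> int \<Rightarrow> complex set \<Rightarrow> color option" where
  "signed_pattern P s E = (if s = 1 then P E else map_option opposite (P E))"

lemma opposite_opposite [simp]: "opposite (opposite c) = c"
  by (cases c) auto

lemma signed_pattern_uminus:
  assumes "s = 1 \<or> s = - 1"
  shows "signed_pattern P (- s) E = map_option opposite (signed_pattern P s E)"
  using assms by (auto simp: signed_pattern_def option.map_comp o_def option.map_ident)

text \<open>Folding inflates by \<open>-2\<close>, the substitution \<open>F\<^sub>+\<close> by \<open>2\<close>: a pattern \<open>P\<close> invariant under the
  inflation by \<open>-2\<close> is turned by \<open>F\<^sub>+\<close> into its rotation by \<open>\<pi>\<close> with the colors exchanged. The
  affine map places the colored triangle in the plane of \<open>P\<close>, rotated by \<open>\<pi>\<close> if \<open>s = -1\<close>.\<close>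

lemma F_plus_signed_pattern:
  assumes s: "s = 1 \<or> s = - 1"
    and half: "\<And>E E'. E \<in> grid_edges \<Longrightarrow> E' \<in> grid_edges \<Longrightarrow> E' \<subseteq> aff (- 2) 0 ` E \<Longrightarrow> P E' = P E"
    and mid: "\<And>U E'. U \<in> grid_triangles \<Longrightarrow> E' \<in> midsegments (aff_tri (- 2) 0 U) \<Longrightarrow>
      E' \<in> grid_edges \<and> P E' = Some (if tri_ratio U > 0 then Red else Blue)"
    and al: "aligned (aff_tri s w t)" and t0: "tri_ratio t \<noteq> 0"
    and D: "D = CTri t (\<lambda>e. if e \<in> unit_edges t then signed_pattern P s (aff s w ` e) else None)"
  defines "t' \<equiv> Tri (tri_center t) (2 * tri_ratio t)"
    and "w' \<equiv> - of_int s *\<^sub>R tri_center t - 2 *\<^sub>R w"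
  shows "F_plus D = CTri t' (\<lambda>e. if e \<in> unit_edges t' then signed_pattern P (- s) (aff (- s) w' ` e)
    else None)"
    and "aligned (aff_tri (- s) w' t')"
proof -
  define p where "p = tri_center t"
  define T where "T = aff_tri s w t"
  have s': "- s = 1 \<or> - s = - 1" and s0: "s \<noteq> 0" using s by auto
  have t': "t' = homothety_tri p 2 t"
    by (simp add: t'_def homothety_tri_def homothety_def p_def)
  \<comment> \<open>The shift \<open>w'\<close> is chosen for this identity: doubling about
    \<open>p\<close> followed by the new placement equals the old placement followed by the
    inflation \<open>- 2\<close> about the origin.\<close>
  have \<phi>: "aff (- s) w' (homothety p 2 x) = aff (- 2) 0 (aff s w x)" for x
    by (simp add: homothety_def aff_def w'_def p_def complex_eq_iff algebra_simps)
  have \<phi>_tri: "aff_tri (- s) w' (homothety_tri p 2 u) = aff_tri (- 2) 0 (aff_tri s w u)" for u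
    by (simp add: homothety_tri_def aff_tri_def \<phi>)
  have T': "aff_tri (- s) w' t' = aff_tri (- 2) 0 T"
    unfolding t' T_def by (rule \<phi>_tri)
  have alT': "aligned (aff_tri (- 2) 0 T)"
    unfolding T_def by (rule aligned_double[OF al])
  then show "aligned (aff_tri (- s) w' t')"
    by (simp only: T')
  have T0: "tri_ratio T \<noteq> 0" "tri_ratio (aff_tri (- 2) 0 T) \<noteq> 0"
    using t0 s0 by (simp_all add: T_def)
  have ue: "e \<in> unit_edges t \<longleftrightarrow> aff s w ` e \<in> grid_edges \<and> aff s w ` e \<subseteq> tri_points T" for e
    using aff_unit_edges_iff[OF s, of w e t] unit_edges_aligned[OF al] T0(1) unfolding T_def by auto
  have ue': "e \<in> unit_edges t' \<longleftrightarrow>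
      aff (- s) w' ` e \<in> grid_edges \<and> aff (- s) w' ` e \<subseteq> tri_points (aff_tri (- 2) 0 T)" for e
    using aff_unit_edges_iff[OF s', of w' e t'] unit_edges_aligned[OF alT' T0(2)] unfolding T'
      by auto
  have ut: "u \<in> unit_triangles t \<longleftrightarrow> aff_tri s w u \<in> grid_triangles \<and> tri_points (aff_tri s w u)
    \<subseteq> tri_points T" for u
    using aff_tri_unit_triangles_iff[OF s, of w u t] unit_triangles_aligned[OF al] unfolding T_def
      by auto
  have sub: "e' \<subseteq> homothety p 2 ` e \<longleftrightarrow> aff (- s) w' ` e' \<subseteq> aff (- 2) 0 ` aff s w ` e" for e e'
  proof -
    have "aff (- 2) 0 ` aff s w ` e = aff (- s) w' ` homothety p 2 ` e"
      by (simp add: image_image \<phi>)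
    then show ?thesis
      using inj_aff[of "- s" w'] s0 by (simp add: inj_image_subset_iff)
  qed
  have ms: "e' \<in> midsegments (homothety_tri p 2 u) \<longleftrightarrow>
      aff (- s) w' ` e' \<in> midsegments (aff_tri (- 2) 0 (aff_tri s w u))" for e' u
  proof -
    have "inj ((`) (aff (- s) w'))"
      using inj_aff[of "- s" w'] s0 by (simp add: inj_image_eq_iff inj_def)
    then show ?thesis
      unfolding \<phi>_tri[symmetric] midsegments_aff_tri by (simp add: inj_image_mem_iff)
  qed
  have shape: "shape D = t" by (simp add: D)
  define col where "col e' = (if e' \<in> unit_edges t' \<and> (\<exists>e\<in>unit_edges t. e' \<subseteq> homothety p 2 ` e)
        then map_option opposite (coloring D (THE e. e \<in> unit_edges t \<and> e' \<subseteq> homothety p 2 ` e))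
        else if \<exists>u\<in>unit_triangles t. tri_ratio u > 0 \<and> e' \<in> midsegments (homothety_tri p 2 u)
        then Some Blue
        else if \<exists>u\<in>unit_triangles t. tri_ratio u < 0 \<and> e' \<in> midsegments (homothety_tri p 2 u)
        then Some Red
        else None)" for e'
  have F: "F_plus D = CTri t' col"
    unfolding F_plus_def Let_def shape col_def p_def[symmetric] t'[symmetric] ..
  have mid_u: "e' \<in> unit_edges t' \<and> signed_pattern P (- s) (aff (- s) w' ` e')
      = Some (if tri_ratio u > 0 then Blue else Red)"
    if u: "u \<in> unit_triangles t" "e' \<in> midsegments (homothety_tri p 2 u)" for e' u
  proof -
    let ?U = "aff_tri s w u" and ?E' = "aff (- s) w' ` e'"
    have U: "?U \<in> grid_triangles" "tri_points ?U \<subseteq> tri_points T"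
      using u(1) ut by blast+
    have E': "?E' \<in> midsegments (aff_tri (- 2) 0 ?U)"
      using u(2) ms by blast
    note m = mid[OF U(1) E']
    have U0: "tri_ratio ?U \<noteq> 0"
      using U(1) unfolding mem_grid_triangles_iff by auto
    have "?E' \<subseteq> tri_points (aff_tri (- 2) 0 T)"
      using midsegments_double_subset[OF U0 E'] U(2) unfolding tri_points_aff_tri by blast
    then have "e' \<in> unit_edges t'"
      using m ue' by blast
    \<comment> \<open>For \<open>s = 1\<close> the placed triangle keeps its orientation and the new
      sign exchanges the colors; for \<open>s = - 1\<close> the orientation is reversed and the
      colors are kept. Both give blue for positive \<open>u\<close>, as \<open>F_plus\<close>
      prescribes.\<close>
    moreover have "signed_pattern P (- s) ?E' = Some (if tri_ratio u > 0 then Blue else Red)"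
      using m s U0 by (auto simp: signed_pattern_def)
    ultimately show ?thesis ..
  qed
  have "col e' = (if e' \<in> unit_edges t' then signed_pattern P (- s) (aff (- s) w' ` e') else None)"
    for e'
  proof -
    let ?E' = "aff (- s) w' ` e'"
    consider (half) e where "e' \<in> unit_edges t'" "e \<in> unit_edges t" "e' \<subseteq> homothety p 2 ` e"
      | (mid) u where "\<not> (e' \<in> unit_edges t' \<and> (\<exists>e\<in>unit_edges t. e' \<subseteq> homothety p 2 ` e))"
          "u \<in> unit_triangles t" "e' \<in> midsegments (homothety_tri p 2 u)"
      | (none) "\<not> (e' \<in> unit_edges t' \<and> (\<exists>e\<in>unit_edges t. e' \<subseteq> homothety p 2 ` e))"
          "\<not> (\<exists>u\<in>unit_triangles t. e' \<in> midsegments (homothety_tri p 2 u))"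
      by blast
    then show ?thesis
    proof cases
      case (half e)
      have E': "?E' \<in> grid_edges"
        using half(1) unfolding ue' by simp
      obtain i x' where x': "edge_pt i x'" "x' \<in> ?E'"
        using grid_edge_generic_point[OF E'] by blast
      obtain x where x: "x' = aff (- 2) 0 x"
        by (rule double_surj)
      have uniq: "aff s w ` e1 = cell x" if "e1 \<in> unit_edges t" "e' \<subseteq> homothety p 2 ` e1" for e1
        by (rule half_edge_cells(2)[OF ue[THEN iffD1, OF that(1), THEN conjunct1] E' sub[THEN
          iffD1, OF that(2)]
            x'[unfolded x]])
      have "(THE e. e \<in> unit_edges t \<and> e' \<subseteq> homothety p 2 ` e) = e"
      proof (rule the_equality)
        fix e1 assume "e1 \<in> unit_edges t \<and> e' \<subseteq> homothety p 2 ` e1"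
        then have "aff s w ` e1 = aff s w ` e"
          using uniq half(2,3) by metis
        then show "e1 = e"
          using inj_aff[OF s0, of w] by (simp add: inj_image_eq_iff)
      qed (use half in blast)
      then have "col e' = map_option opposite (signed_pattern P s (aff s w ` e))"
        using half unfolding col_def by (auto simp: D)
      also have "\<dots> = signed_pattern P (- s) (aff s w ` e)"
        by (simp add: signed_pattern_uminus[OF s])
      also have "\<dots> = signed_pattern P (- s) ?E'"
        unfolding signed_pattern_def
          assms(2)[OF ue[THEN iffD1, OF half(2), THEN conjunct1] E' sub[THEN iffD1, OF half(3)]] ..
      finally show ?thesis using half(1) by simp
    next
      case (mid u)
      have u0: "tri_ratio u \<noteq> 0"
        using mid(2) ut[of u] s0 unfolding mem_grid_triangles_iff by auto
      show ?thesis
      proof (cases "\<exists>u\<in>unit_triangles t. tri_ratio u > 0 \<and> e' \<in> midsegments (homothety_tri p 2 u)")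
        case True
        then have "e' \<in> unit_edges t' \<and> signed_pattern P (- s) ?E' = Some Blue"
          using mid_u by fastforce
        then show ?thesis
          unfolding col_def using True mid(1) by auto
      next
        case False
        then have neg: "tri_ratio u < 0"
          using mid u0 by force
        then have "e' \<in> unit_edges t' \<and> signed_pattern P (- s) ?E' = Some Red"
          using mid_u[OF mid(2,3)] by simp
        then show ?thesis
          unfolding col_def using False mid neg by auto
      qed
    next
      case none
      \<comment> \<open>By \<open>double_edge_cases\<close> every unit edge of the doubled triangle
        falls under one of the two rules, once its preimage is moved back through the
        placement.\<close>
      have "e' \<notin> unit_edges t'"
      proof
        assume e': "e' \<in> unit_edges t'"
        then have "?E' \<in> grid_edges" "?E' \<subseteq> tri_points (aff_tri (- 2) 0 T)"
          using ue' by blast+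
        with al[folded T_def] T0(1) show False
        proof (cases rule: double_edge_cases)
          case (1 E)
          have "aff s w (aff s (- of_int s *\<^sub>R w) y) = y" for y
            using s by (auto simp: aff_def)
          then have "aff s w ` aff s (- of_int s *\<^sub>R w) ` E = E"
            unfolding image_image by simp
          then have "aff s (- of_int s *\<^sub>R w) ` E \<in> unit_edges t"
            "e' \<subseteq> homothety p 2 ` aff s (- of_int s *\<^sub>R w) ` E"
            using 1 ue sub by auto
          then show False using none(1) e' by blast
        next
          case (2 U)
          have "aff_tri s w (aff_tri s (- of_int s *\<^sub>R w) U) = U"
            using s by (auto simp: aff_tri_aff_tri aff_def aff_tri_def)
          then have "aff_tri s (- of_int s *\<^sub>R w) U \<in> unit_triangles t"
            "e' \<in> midsegments (homothety_tri p 2 (aff_tri s (- of_int s *\<^sub>R w) U))"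
            using 2 ut ms by simp_all
          then show False using none(2) by blast
        qed
      qed
      then show ?thesis
        using none unfolding col_def by auto
    qed
  qed
  then show "F_plus D = CTri t' (\<lambda>e. if e \<in> unit_edges t'
    then signed_pattern P (- s) (aff (- s) w' ` e) else None)"
    unfolding F by (simp add: fun_eq_iff)
qed

text \<open>Two applications of \<open>F_plus\<close> restore the sign. The new shift sends the
  center \<open>c\<close> to \<open>4 (c + w)\<close>, so the placed triangle is inflated by
  \<open>4\<close> about the origin.\<close>

lemma F_P_folding_pattern:
  assumes up: "\<forall>i\<ge>1. S i = Up" and al: "aligned (aff_tri 1 w (Tri c m))" and m: "m \<noteq> 0"
  shows "F_P (CTri (Tri c m) (\<lambda>e. if e \<in> unit_edges (Tri c m) then folding_pattern S (aff 1 w ` e)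
    else None))
    = CTri (Tri c (4 * m)) (\<lambda>e. if e \<in> unit_edges (Tri c (4 * m))
        then folding_pattern S (aff 1 (3 *\<^sub>R c + 4 *\<^sub>R w) ` e) else None)"
proof -
  let ?P = "folding_pattern S"
  have sp: "signed_pattern ?P 1 = ?P"
    by (rule ext) (simp add: signed_pattern_def)
  have half: "?P E' = ?P E" if "E \<in> grid_edges" "E' \<in> grid_edges" "E' \<subseteq> aff (- 2) 0 ` E" for E E'
    using folding_pattern_half_edge[OF up that] .
  have mid: "E' \<in> grid_edges \<and> ?P E' = Some (if tri_ratio U > 0 then Red else Blue)"
    if "U \<in> grid_triangles" "E' \<in> midsegments (aff_tri (- 2) 0 U)" for U E'
    using folding_pattern_midsegment[OF up that] by blast
  let ?w' = "- of_int 1 *\<^sub>R c - 2 *\<^sub>R w"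
  let ?D' = "CTri (Tri c (2 * m)) (\<lambda>e. if e \<in> unit_edges (Tri c (2 * m))
    then signed_pattern ?P (- 1) (aff (- 1) ?w' ` e) else None)"
  have step1: "F_plus (CTri (Tri c m) (\<lambda>e. if e \<in> unit_edges (Tri c m) then ?P (aff 1 w ` e)
    else None)) = ?D'"
    and al': "aligned (aff_tri (- 1) ?w' (Tri c (2 * m)))"
    using F_plus_signed_pattern[of 1 ?P w "Tri c m", OF _ half mid al _ refl] m
      by (simp_all add: sp cong: if_cong)
  have "F_plus ?D' = CTri (Tri c (2 * (2 * m))) (\<lambda>e. if e \<in> unit_edges (Tri c (2 * (2 * m)))
      then signed_pattern ?P (- (- 1)) (aff (- (- 1)) (- of_int (- 1) *\<^sub>R c - 2 *\<^sub>R ?w') ` e)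
        else None)"
    using F_plus_signed_pattern(1)[of "- 1" ?P ?w' "Tri c (2 * m)", OF _ half mid al' _ refl] m
      by (simp cong: if_cong)
  moreover have "- of_int (- 1) *\<^sub>R c - 2 *\<^sub>R ?w' = 3 *\<^sub>R c + 4 *\<^sub>R w"
    by (simp add: complex_eq_iff)
  ultimately show ?thesis
    unfolding F_P_def o_def step1 by (simp add: sp cong: if_cong)
qed

section \<open>The seed and its iterated supertriangles\<close>

lemma unit_triangles_grid_triangle:
  assumes "t \<in> grid_triangles"
  shows "unit_triangles t = {t}"
proof -
  have "aligned t" using assms by (simp add: mem_grid_triangles_iff)
  then show ?thesis
    using unit_triangles_aligned[of t] grid_triangle_eq[OF assms] center_notin_grid(2) assms by auto
qed

lemma unit_edges_grid_triangle: "t \<in> grid_triangles \<Longrightarrow> unit_edges t = sides t"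
  by (simp add: unit_edges_def unit_triangles_grid_triangle)

lemma T0_grid_triangle: "T0 \<in> grid_triangles"
  using aligned_paper[of 0] by (simp add: mem_grid_triangles_iff)

lemma aligned_supertriangle: "aligned (Tri 0 (4 ^ n))"
  using aligned_paper[of "2 * n"] by (simp add: power_mult)

text \<open>The sides of \<open>T0\<close> are the midsegments of \<open>- 2 T0\<close>, and
  \<open>T0\<close> is positive.\<close>

lemma folding_pattern_T0:
  assumes "\<forall>i\<ge>1. S i = Up" "e \<in> sides T0"
  shows "folding_pattern S e = Some Red"
proof -
  have "e \<in> midsegments (aff_tri (- 2) 0 T0)"
    using assms(2) midsegments_double[of 0 1] by (simp add: aff_0)
  then show ?thesis
    using folding_pattern_midsegment(2)[OF assms(1) T0_grid_triangle] by simp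
qed

lemma F_P_seed:
  assumes up: "\<forall>i\<ge>1. S i = Up"
  shows "(F_P ^^ n) seed = CTri (Tri 0 (4 ^ n)) (folding_pattern S |` {e \<in> grid_edges. e
    \<subseteq> tri_points (Tri 0 (4 ^ n))})"
proof -
  have ue: "unit_edges (Tri 0 (4 ^ n)) = {e \<in> grid_edges. e \<subseteq> tri_points (Tri 0 (4 ^ n))}" for n
    by (rule unit_edges_aligned[OF aligned_supertriangle]) simp
  have "(F_P ^^ n) seed = CTri (Tri 0 (4 ^ n)) (\<lambda>e. if e \<in> unit_edges (Tri 0 (4 ^ n))
    then folding_pattern S (aff 1 0 ` e) else None)"
  proof (induction n)
    case 0
    show ?case
      using folding_pattern_T0[OF up] unit_edges_grid_triangle[OF T0_grid_triangle]
      by (auto simp: seed_def fun_eq_iff)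
  next
    case (Suc n)
    have "aligned (aff_tri 1 0 (Tri 0 (4 ^ n)))"
      using aligned_supertriangle by simp
    from F_P_folding_pattern[OF up this] show ?case
      by (simp add: Suc.IH cong: if_cong)
  qed
  then show ?thesis
    unfolding ue by (simp add: restrict_map_def cong: if_cong)
qed

section \<open>Decorated tiles and the tile substitution\<close>

lemma side_inj:
  assumes "tri_ratio t \<noteq> 0" "i \<in> {1,2,3}" "j \<in> {1,2,3}" "side t i = side t j"
  shows "i = j"
proof (rule ccontr)
  assume "i \<noteq> j"
  obtain c m where t: "t = Tri c m" by (cases t)
  then have m: "m \<noteq> 0" using assms(1) by simp
  have "vertex t j \<in> side t j"
    using vertex_in_side[OF assms(2,3) \<open>i \<noteq> j\<close>, of t] assms(4) by blast
  then have "coord j (vertex t j) = coord j c + m / 3"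
    unfolding t mem_side_iff[OF m assms(3)] by blast
  moreover have "coord j (vertex t j) = coord j c - 2 * m / 3"
    using assms(3) unfolding t by (auto simp: vertex_def coord_def xi_simps inner_complex_def
      field_simps)
  ultimately show False using m by simp
qed

lemma tile_triangle_decorate [simp]: "tile_triangle (decorate P t) = t"
  by (simp add: decorate_def Let_def)

lemma decorate_cong:
  assumes "\<And>e. e \<in> sides t \<Longrightarrow> P e = Q e"
  shows "decorate P t = decorate Q t"
proof -
  have "P (side t i) = Q (side t i)" if "i \<in> {1,2,3}" for i
    using that assms unfolding sides_def by blast
  then have "i \<in> {1,2,3} \<and> P (side t i) = Some c \<longleftrightarrow> i \<in> {1,2,3} \<and> Q (side t i) = Some c" for i c
    by (intro conj_cong) simp_all
  then show ?thesis
    unfolding decorate_def by (simp only:)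
qed

text \<open>The decoration loses nothing: if all three sides are colored, the red count and the mark
  determine the color of every side.\<close>

lemma decorate_color:
  assumes "\<And>i. i \<in> {1,2,3} \<Longrightarrow> P (side t i) \<noteq> None" "j \<in> {1,2,3}"
  defines "w \<equiv> decorate P t"
  shows "P (side t j) = (if red_count w = 0 then Some Blue
    else if red_count w = 1 then Some (if mark w = Some j then Red else Blue)
    else if red_count w = 2 then Some (if mark w = Some j then Blue else Red)
    else Some Red)"
proof -
  define f where "f i = P (side t i)" for i
  have f: "f i = Some Red \<or> f i = Some Blue" if "i \<in> {1,2,3}" for i
    using assms(1)[OF that] by (metis color.exhaust f_def option.exhaust)
  have R: "{i \<in> {1,2,3}. f i = Some Red} = (if f 1 = Some Red then {1} else {})
      \<union> (if f 2 = Some Red then {2} else {}) \<union> (if f 3 = Some Red then {3} else {})"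
    by auto
  have T1: "(THE i. i \<in> {1,2,3} \<and> f i = Some c) = k"
    if "k \<in> {1,2,3}" "f k = Some c" "\<And>i. i \<in> {1,2,3} \<Longrightarrow> i \<noteq> k \<Longrightarrow> f i \<noteq> Some c" for k c
    using that by blast
  have w: "red_count w = card {i \<in> {1,2,3}. f i = Some Red}"
    "mark w = (if red_count w = 1 then Some (THE i. i \<in> {1,2,3} \<and> f i = Some Red)
         else if red_count w = 2 then Some (THE i. i \<in> {1,2,3} \<and> f i = Some Blue)
         else None)"
    by (simp_all add: w_def decorate_def Let_def f_def)
  consider "f 1 = Some Red" "f 2 = Some Red" "f 3 = Some Red"
    | "f 1 = Some Red" "f 2 = Some Red" "f 3 = Some Blue"
    | "f 1 = Some Red" "f 2 = Some Blue" "f 3 = Some Red"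
    | "f 1 = Some Red" "f 2 = Some Blue" "f 3 = Some Blue"
    | "f 1 = Some Blue" "f 2 = Some Red" "f 3 = Some Red"
    | "f 1 = Some Blue" "f 2 = Some Red" "f 3 = Some Blue"
    | "f 1 = Some Blue" "f 2 = Some Blue" "f 3 = Some Red"
    | "f 1 = Some Blue" "f 2 = Some Blue" "f 3 = Some Blue"
    using f[of 1] f[of 2] f[of 3] by auto
  then have "f j = (if red_count w = 0 then Some Blue
    else if red_count w = 1 then Some (if mark w = Some j then Red else Blue)
    else if red_count w = 2 then Some (if mark w = Some j then Blue else Red)
    else Some Red)"
  proof cases
    case 1
    then show ?thesis using assms(2) unfolding w R by auto
  next
    case 2
    then have "(THE i. i \<in> {1,2,3} \<and> f i = Some Blue) = 3" by (intro T1) auto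
    then show ?thesis using 2 assms(2) unfolding w R by auto
  next
    case 3
    then have "(THE i. i \<in> {1,2,3} \<and> f i = Some Blue) = 2" by (intro T1) auto
    then show ?thesis using 3 assms(2) unfolding w R by auto
  next
    case 4
    then have "(THE i. i \<in> {1,2,3} \<and> f i = Some Red) = 1" by (intro T1) auto
    then show ?thesis using 4 assms(2) unfolding w R by auto
  next
    case 5
    then have "(THE i. i \<in> {1,2,3} \<and> f i = Some Blue) = 1" by (intro T1) auto
    then show ?thesis using 5 assms(2) unfolding w R by auto
  next
    case 6
    then have "(THE i. i \<in> {1,2,3} \<and> f i = Some Red) = 2" by (intro T1) auto
    then show ?thesis using 6 assms(2) unfolding w R by auto
  next
    case 7
    then have "(THE i. i \<in> {1,2,3} \<and> f i = Some Red) = 3" by (intro T1) auto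
    then show ?thesis using 7 assms(2) unfolding w R by auto
  next
    case 8
    then show ?thesis using assms(2) unfolding w R by auto
  qed
  then show ?thesis by (simp add: f_def)
qed

text \<open>Recentering moves the tile from center \<open>c\<close> to \<open>4 c\<close> with its
  decoration; the shift by \<open>- 3 c\<close> leads back to the tile on which \<open>P\<close> is
  read.\<close>

lemma colored_of_recenter_decorate:
  assumes "\<And>e. e \<in> sides t \<Longrightarrow> P e \<noteq> None" "tri_ratio t \<noteq> 0"
  defines "t' \<equiv> Tri (4 * tri_center t) (tri_ratio t)"
  shows "colored_of_tile (recenter (decorate P t))
    = CTri t' (\<lambda>e. if e \<in> sides t' then P (aff 1 (- 3 *\<^sub>R tri_center t) ` e) else None)"
proof -
  define w where "w = decorate P t"
  have rw: "recenter w = Tile t' (red_count w) (mark w)"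
    by (simp add: recenter_def w_def t'_def)
  have t: "t = aff_tri 1 (- 3 *\<^sub>R tri_center t) t'"
    by (cases t) (simp add: t'_def aff_tri_def aff_def complex_eq_iff)
  have nz: "tri_ratio t' \<noteq> 0" using assms(2) by (simp add: t'_def)
  have "coloring (colored_of_tile (recenter w)) e = P (aff 1 (- 3 *\<^sub>R tri_center t) ` e)" if "e
    \<in> sides t'" for e
  proof -
    from that obtain j where j: "e = side t' j" "j \<in> {1,2,3}"
      unfolding sides_def by (rule imageE)
    note j = j(2,1)
    have e: "aff 1 (- 3 *\<^sub>R tri_center t) ` e = side t j"
      using side_aff_tri[of 1 "- 3 *\<^sub>R tri_center t" t' j] t j(2) by simp
    have marked: "marked_side (recenter w) e \<longleftrightarrow> mark w = Some j"
    proof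
      assume "marked_side (recenter w) e"
      then obtain i where i: "i \<in> {1,2,3}"
        "mark (recenter w) = Some i \<and> e = side (tile_triangle (recenter w)) i"
        unfolding marked_side_def by (rule bexE)
      have "j = i"
        by (rule side_inj[OF nz j(1) i(1)]) (use i(2) j(2) rw in simp)
      then show "mark w = Some j"
        using i(2) rw by simp
    next
      assume "mark w = Some j"
      then show "marked_side (recenter w) e"
        unfolding marked_side_def using j rw by (intro bexI[of _ j]) simp_all
    qed
    have ne: "P (side t i) \<noteq> None" if "i \<in> {1,2,3}" for i
      using that assms(1) unfolding sides_def by blast
    have "P (side t j) = (if red_count w = 0 then Some Blue
        else if red_count w = 1 then Some (if mark w = Some j then Red else Blue)
        else if red_count w = 2 then Some (if mark w = Some j then Blue else Red)
        else Some Red)"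
      unfolding w_def by (rule decorate_color[of P t, OF ne j(1)])
    then show ?thesis
      unfolding e colored_of_tile_def colored_triangle.sel marked using that by (simp add: rw)
  qed
  then show ?thesis
    unfolding w_def[symmetric] by (auto simp: colored_of_tile_def rw fun_eq_iff)
qed

lemma folding_pattern_ne_None: "e \<in> grid_edges \<Longrightarrow> folding_pattern S e \<noteq> None"
  by (simp add: folding_pattern_def)

lemma aligned_quadruple: "aligned t \<Longrightarrow> aligned (aff_tri 4 0 t)"
  using aligned_aff_tri_0[of t 1] by simp

lemma substitute_tile_folding_tiling:
  assumes up: "\<forall>i\<ge>1. S i = Up" and t: "t \<in> grid_triangles"
  shows "substitute_tile (recenter (decorate (folding_pattern S) t))
    = decorate (folding_pattern S) ` {u \<in> grid_triangles. tri_points u \<subseteq> aff 4 0 ` tri_points t}"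
proof -
  let ?P = "folding_pattern S" and ?v = "- 3 *\<^sub>R tri_center t"
  define t' where "t' = Tri (4 * tri_center t) (tri_ratio t)"
  have t_eq: "aff_tri 1 ?v t' = t"
    by (cases t) (simp add: t'_def aff_tri_def aff_def complex_eq_iff)
  have al: "aligned t" and r: "tri_ratio t \<noteq> 0"
    using t by (auto simp: mem_grid_triangles_iff)
  have ne: "?P e \<noteq> None" if "e \<in> sides t" for e
    using folding_pattern_ne_None that t unfolding grid_edges_def by blast
  have "e \<in> unit_edges t' \<longleftrightarrow> e \<in> sides t'" for e
  proof -
    have "e \<in> unit_edges t' \<longleftrightarrow> aff 1 ?v ` e \<in> sides t"
      using aff_unit_edges_iff[of 1 ?v e t'] unit_edges_grid_triangle[OF t] unfolding t_eq by simp
    also have "\<dots> \<longleftrightarrow> aff 1 ?v ` e \<in> (`) (aff 1 ?v) ` sides t'"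
      unfolding sides_aff_tri[symmetric] t_eq ..
    also have "\<dots> \<longleftrightarrow> e \<in> sides t'"
    proof -
      have "inj ((`) (aff 1 ?v))"
        using inj_aff[of 1 ?v] by (simp add: inj_image_eq_iff inj_def)
      then show ?thesis by (simp only: inj_image_mem_iff)
    qed
    finally show ?thesis .
  qed
  then have col: "colored_of_tile (recenter (decorate ?P t))
      = CTri t' (\<lambda>e. if e \<in> unit_edges t' then ?P (aff 1 ?v ` e) else None)"
    using colored_of_recenter_decorate[OF ne r] unfolding t'_def[symmetric] by (simp only:)
  define T where "T = aff_tri 4 0 t"
  have T: "T = Tri (4 * tri_center t) (4 * tri_ratio t)"
    by (simp add: T_def aff_tri_def aff_0 complex_eq_iff)
  have alT: "aligned T" "tri_ratio T \<noteq> 0"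
    using aligned_quadruple[OF al] r by (simp_all add: T_def)
  \<comment> \<open>With center \<open>4 c\<close> and shift \<open>- 3 c\<close> the shift after
    \<open>F_P\<close> vanishes, so the supertile already lies at its place in the pattern.\<close>
  have "3 *\<^sub>R (4 * tri_center t) + 4 *\<^sub>R ?v = 0"
    by (simp add: complex_eq_iff)
  then have F: "F_P (colored_of_tile (recenter (decorate ?P t)))
      = CTri T (\<lambda>e. if e \<in> unit_edges T then ?P e else None)"
    unfolding col T t'_def
    using F_P_folding_pattern[OF up, of ?v "4 * tri_center t" "tri_ratio t"] t_eq al r
    by (simp add: t'_def cong: if_cong)
  have "decorate (\<lambda>e. if e \<in> unit_edges T then ?P e else None) u = decorate ?P u" if "u
    \<in> unit_triangles T" for u
    by (rule decorate_cong) (use that in \<open>auto simp: unit_edges_def\<close>)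
  then have "substitute_tile (recenter (decorate ?P t)) = decorate ?P ` unit_triangles T"
    unfolding substitute_tile_def tiles_of_def F by simp
  then show ?thesis
    unfolding unit_triangles_aligned[OF alT(1)] by (simp add: T_def tri_points_aff_tri)
qed

text \<open>The center of \<open>u\<close>, divided by \<open>4\<close>, is off the grid since
  inflation by \<open>4\<close> preserves the grid; the unit triangle around it is the required
  \<open>v\<close>.\<close>

lemma quadruple_covers:
  assumes t: "aligned t" "tri_ratio t \<noteq> 0" and u: "u \<in> grid_triangles" "tri_points u
    \<subseteq> aff 4 0 ` tri_points t"
  obtains v where "v \<in> grid_triangles" "tri_points v \<subseteq> tri_points t" "tri_points u
    \<subseteq> aff 4 0 ` tri_points v"
proof -
  define x where "x = (1 / 4) *\<^sub>R tri_center u"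
  have cx: "tri_center u = aff 4 0 x" by (simp add: x_def aff_0)
  have "aff 4 0 x \<in> aff 4 0 ` tri_points t"
    using u(2) center_notin_grid(2)[OF u(1)] unfolding cx by blast
  then have xt: "x \<in> tri_points t"
    using inj_aff[of 4 0] by (simp add: inj_image_mem_iff)
  have x: "x \<notin> grid"
    using aff_0_in_grid[of x 1] center_notin_grid(1)[OF u(1)] unfolding cx by auto
  obtain v where v: "v \<in> grid_triangles" "x \<in> tri_points v"
    using off_grid_triangle[OF x] by blast
  have cv: "tri_points v = cell x"
    by (rule off_grid_cell(1)[OF v x])
  have "tri_points u = cell (aff 4 0 x)"
    using off_grid_cell(1)[OF u(1)] center_notin_grid[OF u(1)] unfolding cx by blast
  then have "tri_points u \<subseteq> aff 4 0 ` tri_points v"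
    using cell_aff_0[of 1 x] cv by simp
  moreover have "tri_points v \<subseteq> tri_points t"
    unfolding cv by (rule cell_subset_tri_points[OF t xt])
  ultimately show ?thesis using that v(1) by blast
qed

lemma F_T_seed:
  assumes up: "\<forall>i\<ge>1. S i = Up"
  shows "(F_T ^^ n) {Tile T0 3 None}
    = {w \<in> folding_tiling S. tri_points (tile_triangle w) \<subseteq> tri_points (Tri 0 (4 ^ n))}"
proof -
  let ?P = "folding_pattern S"
  define W where "W n = {t \<in> grid_triangles. tri_points t \<subseteq> tri_points (Tri 0 (4 ^ n))}"
    for n :: nat
  have W: "{w \<in> folding_tiling S. tri_points (tile_triangle w) \<subseteq> tri_points (Tri 0 (4 ^ n))}
    = decorate ?P ` W n" for n
    by (auto simp: folding_tiling_def W_def)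
  have "(F_T ^^ n) {Tile T0 3 None} = decorate ?P ` W n"
  proof (induction n)
    case 0
    have "W 0 = {T0}"
      using unit_triangles_aligned[of T0] aligned_supertriangle[of 0]
        unit_triangles_grid_triangle[OF T0_grid_triangle]
      by (simp add: W_def)
    moreover have "decorate ?P T0 = Tile T0 3 None"
    proof -
      have "{i \<in> {1,2,3}. ?P (side T0 i) = Some Red} = {1,2,3}"
        using folding_pattern_T0[OF up] unfolding sides_def by blast
      then have "card {i \<in> {1,2,3}. ?P (side T0 i) = Some Red} = 3"
        by simp
      then show ?thesis
        unfolding decorate_def Let_def by simp
    qed
    ultimately show ?case by simp
  next
    case (Suc n)
    have "Tri 0 (4 ^ Suc n) = aff_tri 4 0 (Tri 0 (4 ^ n))"
      by (simp add: aff_tri_def aff_0)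
    then have next_tri: "tri_points (Tri 0 (4 ^ Suc n)) = aff 4 0 ` tri_points (Tri 0 (4 ^ n))"
      by (simp only: tri_points_aff_tri)
    have "(F_T ^^ Suc n) {Tile T0 3 None} = (\<Union>t\<in>W n. substitute_tile (recenter (decorate ?P t)))"
      by (simp add: Suc.IH F_T_def)
    also have "\<dots> = (\<Union>t\<in>W n. decorate ?P ` {u \<in> grid_triangles. tri_points u
      \<subseteq> aff 4 0 ` tri_points t})"
      by (rule SUP_cong[OF refl]) (simp add: W_def substitute_tile_folding_tiling[OF up])
    also have "\<dots> = decorate ?P ` (\<Union>t\<in>W n. {u \<in> grid_triangles. tri_points u
      \<subseteq> aff 4 0 ` tri_points t})"
      by blast
    also have "(\<Union>t\<in>W n. {u \<in> grid_triangles. tri_points u \<subseteq> aff 4 0 ` tri_points t}) = W (Suc n)"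
    proof
      show "(\<Union>t\<in>W n. {u \<in> grid_triangles. tri_points u \<subseteq> aff 4 0 ` tri_points t}) \<subseteq> W (Suc n)"
        unfolding W_def next_tri by blast
      show "W (Suc n) \<subseteq> (\<Union>t\<in>W n. {u \<in> grid_triangles. tri_points u \<subseteq> aff 4 0 ` tri_points t})"
      proof
        fix u assume "u \<in> W (Suc n)"
        then have u: "u \<in> grid_triangles" "tri_points u \<subseteq> aff 4 0 ` tri_points (Tri 0 (4 ^ n))"
          unfolding W_def next_tri by blast+
        obtain v where "v \<in> grid_triangles" "tri_points v \<subseteq> tri_points (Tri 0 (4 ^ n))"
          "tri_points u \<subseteq> aff 4 0 ` tri_points v"
          using quadruple_covers[OF aligned_supertriangle _ u] by auto
        then show "u \<in> (\<Union>t\<in>W n. {u \<in> grid_triangles. tri_points u \<subseteq> aff 4 0 ` tri_points t})"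
          using u(1) unfolding W_def by blast
      qed
    qed
    finally show ?case .
  qed
  then show ?thesis unfolding W .
qed

text \<open>It suffices that the point \<open>x\<close> lies in the triangle, which holds for all
  large paper triangles, in particular for those of even level.\<close>

lemma cell_in_supertriangle:
  obtains N where "\<And>n. n \<ge> N \<Longrightarrow> cell x \<subseteq> tri_points (Tri 0 (4 ^ n))"
proof -
  obtain K where K: "\<And>k. k \<ge> K \<Longrightarrow> inside k x"
    using eventually_inside[of x] unfolding eventually_sequentially by blast
  have "cell x \<subseteq> tri_points (Tri 0 (4 ^ n))" if "n \<ge> K" for n
  proof -
    have "x \<in> tri_points (paper (2 * n))"
      using K[of "2 * n"] that by (simp add: inside_iff)
    then show ?thesis
      using cell_subset_tri_points[OF aligned_supertriangle[of n]] by (simp add: power_mult)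
  qed
  then show ?thesis using that by blast
qed

theorem theorem4p2:
  fixes S :: "nat \<Rightarrow> folding"
  assumes "\<forall>i\<ge>1. S i = Up"
  shows "(\<forall>n::nat.
            shape ((F_P ^^ n) seed) = Tri 0 (4 ^ n) \<and>
            coloring ((F_P ^^ n) seed)
              = folding_pattern S |` {e \<in> grid_edges. e \<subseteq> tri_points (Tri 0 (4 ^ n))}) \<and>
         generates_pattern F_P seed (folding_pattern S) \<and>
         (\<forall>n::nat.
            (F_T ^^ n) {Tile T0 3 None}
              = {w \<in> folding_tiling S. tri_points (tile_triangle w) \<subseteq> tri_points (Tri 0 (4 ^ n))}) \<and>
         generates_tiling F_T {Tile T0 3 None} (folding_tiling S)"
proof (intro conjI)
  let ?P = "folding_pattern S"
  show "\<forall>n. shape ((F_P ^^ n) seed) = Tri 0 (4 ^ n) \<and>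
            coloring ((F_P ^^ n) seed) = ?P |` {e \<in> grid_edges. e \<subseteq> tri_points (Tri 0 (4 ^ n))}"
    by (simp add: F_P_seed[OF assms])
  show "generates_pattern F_P seed ?P"
    unfolding generates_pattern_def F_P_seed[OF assms] colored_triangle.sel
  proof (intro allI iffI)
    fix e c
    assume Pe: "?P e = Some c"
    then have e: "e \<in> grid_edges"
      by (simp add: folding_pattern_def split: if_splits)
    then obtain i x where "edge_pt i x" "x \<in> e"
      using grid_edge_generic_point by blast
    then have "e = cell x"
      using grid_edge_eq_cell e by blast
    moreover obtain N where "\<And>n. n \<ge> N \<Longrightarrow> cell x \<subseteq> tri_points (Tri 0 (4 ^ n))"
      using cell_in_supertriangle by blast
    ultimately show "\<exists>N. \<forall>n\<ge>N. (?P |` {e \<in> grid_edges. e \<subseteq> tri_points (Tri 0 (4 ^ n))}) e = Some c"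
      using e Pe by (intro exI[of _ N]) auto
  next
    fix e c
    assume "\<exists>N. \<forall>n\<ge>N. (?P |` {e \<in> grid_edges. e \<subseteq> tri_points (Tri 0 (4 ^ n))}) e = Some c"
    then obtain n where "(?P |` {e \<in> grid_edges. e \<subseteq> tri_points (Tri 0 (4 ^ n))}) e = Some c"
      by blast
    then show "?P e = Some c"
      by (simp add: restrict_map_def split: if_splits)
  qed
  show "\<forall>n. (F_T ^^ n) {Tile T0 3 None}
      = {w \<in> folding_tiling S. tri_points (tile_triangle w) \<subseteq> tri_points (Tri 0 (4 ^ n))}"
    using F_T_seed[OF assms] by blast
  show "generates_tiling F_T {Tile T0 3 None} (folding_tiling S)"
    unfolding generates_tiling_def F_T_seed[OF assms]
  proof (intro conjI allI ballI)
    fix w assume w: "w \<in> folding_tiling S"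
    then obtain t where t: "t \<in> grid_triangles" "w = decorate ?P t"
      unfolding folding_tiling_def by blast
    have "tri_points t = cell (tri_center t)"
      using off_grid_cell(1)[OF t(1)] center_notin_grid[OF t(1)] by blast
    moreover obtain N where "\<And>n. n \<ge> N \<Longrightarrow> cell (tri_center t) \<subseteq> tri_points (Tri 0 (4 ^ n))"
      using cell_in_supertriangle by blast
    ultimately show "\<exists>N. \<forall>n\<ge>N. w \<in> {w \<in> folding_tiling S. tri_points (tile_triangle w)
      \<subseteq> tri_points (Tri 0 (4 ^ n))}"
      using w t(2) by auto
  qed blast
qed

end
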